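(* Let $\mathrm{R}$ be a real closed field, $\mathrm{C}=\mathrm{R}[i]$, let $F/G \in \mathrm{C}(Z)\setminus\{0\}$ and let $\Gamma=[x_0,x_1]\times[y_0,y_1]\subset \mathrm{R}^2$ with $x_0<x_1$, $y_0<y_1$, such that $F/G$ has no zeros or poles at the vertices of $\Gamma$ (i.e. $\mathrm{val}_z(F/G)=0$ at each vertex $z$). Then $$\mathrm{w}(F/G \mid \partial\Gamma)=\sum_{z\in\Gamma} c_\Gamma(z)\,\mathrm{val}_z(F/G),$$ where $c_\Gamma(z)=1$ if $z$ is in the interior of $\Gamma$ and $c_\Gamma(z)=\tfrac12$ if $z$ lies on an edge of $\Gamma$. In words: $\mathrm{w}(F/G\mid\partial\Gamma)$ counts zeros (with multiplicity) minus poles (with order) of $F/G$ in $\Gamma$, with zeros and poles on the edges counting one half.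
   Context: Points $(x,y)\in\mathrm{R}^2$ are identified with $x+iy\in\mathrm{C}$. For nonzero $P\in\mathrm{R}[X]$ and $x\in\mathrm{R}$ write uniquely $P=(X-x)^{\mathrm{mult}_x(P)}P_x$ with $P_x(x)\neq0$; for $P,Q\neq0$ set $\mathrm{val}_x(P/Q)=\mathrm{mult}_x(P)-\mathrm{mult}_x(Q)$. For $P,Q\in\mathrm{R}[X]$, $x\in\mathrm{R}$: $\mathrm{Ind}^+_x(P,Q)=\tfrac12\,\mathrm{sign}(P_x(x)Q_x(x))$ and $\mathrm{Ind}^-_x(P,Q)=\tfrac12(-1)^{\mathrm{val}_x(P/Q)}\mathrm{sign}(P_x(x)Q_x(x))$ if $P\ne0$, $Q\neq0$ and $\mathrm{val}_x(P/Q)<0$, and both are $0$ otherwise; $\mathrm{Ind}_x=\mathrm{Ind}^+_x-\mathrm{Ind}^-_x$. For $a<b$, $\mathrm{Ind}_a^b(P,Q)=\mathrm{Ind}_a^+(P,Q)+\sum_{x\in(a,b)}\mathrm{Ind}_x(P,Q)-\mathrm{Ind}_b^-(P,Q)$; $\mathrm{Ind}_a^b=-\mathrm{Ind}_b^a$ if $b<a$, and $\mathrm{Ind}_a^a=0$. For $F\in\mathrm{C}[X,Y]$ let $F_{\rm re},F_{\rm im}\in\mathrm{R}[X,Y]$ with $F=F_{\rm re}+iF_{\rm im}$, and $\overline F=F_{\rm re}-iF_{\rm im}$. Define $\mathrm{w}(F\mid\partial\Gamma)=\tfrac12\big(\mathrm{Ind}_{x_0}^{x_1}(F_{\rm re}(T,y_0),F_{\rm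 im}(T,y_0))+\mathrm{Ind}_{y_0}^{y_1}(F_{\rm re}(x_1,T),F_{\rm im}(x_1,T))+\mathrm{Ind}_{x_1}^{x_0}(F_{\rm re}(T,y_1),F_{\rm im}(T,y_1))+\mathrm{Ind}_{y_1}^{y_0}(F_{\rm re}(x_0,T),F_{\rm im}(x_0,T))\big)$. $\mathrm{C}[Z]\subset\mathrm{C}[X,Y]$ via $Z=X+iY$. For $F,G\in\mathrm{C}[X,Y]$, $G\neq0$, $\mathrm{w}(F/G\mid\partial\Gamma):=\mathrm{w}(F\overline G\mid\partial\Gamma)$ (independent of the representation). For nonzero $F\in\mathrm{C}[Z]$, $z\in\mathrm{C}$ write $F=(Z-z)^{\mathrm{mult}_z(F)}F_z$ with $F_z(z)\ne0$, and $\mathrm{val}_z(F/G)=\mathrm{mult}_z(F)-\mathrm{mult}_z(G)$ for $F,G\ne0$. *)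

theory Defs
  imports "HOL-Computational_Algebra.Polynomial"
begin

class real_closed_field = linordered_field +
  assumes nonneg_is_square: "0 \<le> x \<Longrightarrow> \<exists>y. y * y = x"
  assumes odd_degree_root:
    "odd n \<Longrightarrow> c n \<noteq> 0 \<Longrightarrow> \<exists>x. (\<Sum>i\<le>n. c i * x ^ i) = 0"

datatype 'a cplx = Cplx (re: 'a) (im: 'a)

lemma cplx_eq_iff: "z = w \<longleftrightarrow> re z = re w \<and> im z = im w"
  by (cases z; cases w) auto

lemma sumsq_ne0: "(a::'a::linordered_field) \<noteq> 0 \<or> b \<noteq> 0 \<Longrightarrow> a * a + b * b \<noteq> 0"
  by (metis add_nonneg_eq_0_iff mult_eq_0_iff zero_le_square)

instantiation cplx :: (linordered_field) field
begin

definition "0 = Cplx 0 0"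
definition "1 = Cplx 1 0"
definition "z + w = Cplx (re z + re w) (im z + im w)"
definition "z - w = Cplx (re z - re w) (im z - im w)"
definition "- z = Cplx (- re z) (- im z)"
definition "z * w = Cplx (re z * re w - im z * im w) (re z * im w + im z * re w)"
definition "inverse (z::'a::linordered_field cplx) = Cplx (re z / (re z * re z + im z * im z))
                            (- im z / (re z * re z + im z * im z))"
definition "z div w = z * inverse w" for z w :: "'a cplx"

instance
proof
  fix a b c :: "'a cplx"
  show "a * b * c = a * (b * c)" by (simp add: cplx_eq_iff times_cplx_def algebra_simps)
  show "a * b = b * a" by (simp add: cplx_eq_iff times_cplx_def algebra_simps)
  show "1 * a = a" by (simp add: cplx_eq_iff times_cplx_def one_cplx_def)
  show "a + b + c = a + (b + c)" by (simp add: cplx_eq_iff plus_cplx_def algebra_simps)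
  show "a + b = b + a" by (simp add: cplx_eq_iff plus_cplx_def algebra_simps)
  show "0 + a = a" by (simp add: cplx_eq_iff plus_cplx_def zero_cplx_def)
  show "- a + a = 0" by (simp add: cplx_eq_iff plus_cplx_def uminus_cplx_def zero_cplx_def)
  show "a - b = a + - b" by (simp add: cplx_eq_iff plus_cplx_def uminus_cplx_def minus_cplx_def)
  show "(a + b) * c = a * c + b * c" by (simp add: cplx_eq_iff plus_cplx_def times_cplx_def algebra_simps)
  show "(0::'a cplx) \<noteq> 1" by (simp add: zero_cplx_def one_cplx_def)
  show "a div b = a * inverse b" by (simp add: divide_cplx_def)
  show "inverse (0::'a cplx) = 0" by (simp add: inverse_cplx_def zero_cplx_def)
  show "a \<noteq> 0 \<Longrightarrow> inverse a * a = 1"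
  proof -
    assume "a \<noteq> 0"
    then have "re a \<noteq> 0 \<or> im a \<noteq> 0" by (cases a) (auto simp: zero_cplx_def)
    then have d: "re a * re a + im a * im a \<noteq> 0" by (rule sumsq_ne0)
    define s where "s = re a * re a + im a * im a"
    have s: "s \<noteq> 0" using d by (simp add: s_def)
    have r: "re a / s * re a - - im a / s * im a = 1"
      using s by (simp add: s_def divide_simps)
    have i: "re a / s * im a + - im a / s * re a = 0"
      using s by (simp add: divide_simps algebra_simps)
    show ?thesis using r i
      by (simp add: cplx_eq_iff inverse_cplx_def times_cplx_def one_cplx_def s_def)
  qed
qed
end

definition cnj :: "'a::linordered_field cplx \<Rightarrow> 'a cplx" where
  "cnj z = Cplx (re z) (- im z)"

definition cofactor :: "'a::field poly \<Rightarrow> 'a \<Rightarrow> 'a poly" where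
  "cofactor P x = P div ([:- x, 1:] ^ order x P)"

definition val_r :: "'a::field poly \<Rightarrow> 'a poly \<Rightarrow> 'a \<Rightarrow> int" where
  "val_r P Q x = int (order x P) - int (order x Q)"

definition ind_plus :: "'a::linordered_field poly \<Rightarrow> 'a poly \<Rightarrow> 'a \<Rightarrow> 'a" where
  "ind_plus P Q x =
     (if P \<noteq> 0 \<and> Q \<noteq> 0 \<and> val_r P Q x < 0
      then sgn (poly (cofactor P x) x * poly (cofactor Q x) x) / 2 else 0)"

definition ind_minus :: "'a::linordered_field poly \<Rightarrow> 'a poly \<Rightarrow> 'a \<Rightarrow> 'a" where
  "ind_minus P Q x =
     (if P \<noteq> 0 \<and> Q \<noteq> 0 \<and> val_r P Q x < 0
      then (-1) ^ nat (- val_r P Q x) * sgn (poly (cofactor P x) x * poly (cofactor Q x) x) / 2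
      else 0)"

definition ind_at :: "'a::linordered_field poly \<Rightarrow> 'a poly \<Rightarrow> 'a \<Rightarrow> 'a" where
  "ind_at P Q x = ind_plus P Q x - ind_minus P Q x"

definition ind_between :: "'a::linordered_field \<Rightarrow> 'a \<Rightarrow> 'a poly \<Rightarrow> 'a poly \<Rightarrow> 'a" where
  "ind_between a b P Q =
     (if a < b then
        ind_plus P Q a + (\<Sum>x\<in>{x. a < x \<and> x < b \<and> ind_at P Q x \<noteq> 0}. ind_at P Q x)
          - ind_minus P Q b
      else if b < a then
        - (ind_plus P Q b + (\<Sum>x\<in>{x. b < x \<and> x < a \<and> ind_at P Q x \<noteq> 0}. ind_at P Q x)
          - ind_minus P Q a)
      else 0)"

text \<open>For H in C[X,Y], restrictions to horizontal / vertical lines as univariate polynomials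
in T.  For F in C[Z] (Z = X + iY): F(T, y) = F(T + i y) and F(x, T) = F(x + i T).\<close>

definition hline :: "'a::linordered_field cplx poly \<Rightarrow> 'a \<Rightarrow> 'a cplx poly" where
  "hline F y = pcompose F [:Cplx 0 y, 1:]"

definition vline :: "'a::linordered_field cplx poly \<Rightarrow> 'a \<Rightarrow> 'a cplx poly" where
  "vline F x = pcompose F [:Cplx x 0, Cplx 0 1:]"

text \<open>The restriction of F * conj(G) (a polynomial in C[X,Y]) to a line, for T real:
  conj(G)(T, y) is G(T, y) with conjugated coefficients.\<close>

definition hline_q :: "'a::linordered_field cplx poly \<Rightarrow> 'a cplx poly \<Rightarrow> 'a \<Rightarrow> 'a cplx poly" where
  "hline_q F G y = hline F y * map_poly cnj (hline G y)"

definition vline_q :: "'a::linordered_field cplx poly \<Rightarrow> 'a cplx poly \<Rightarrow> 'a \<Rightarrow> 'a cplx poly" where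
  "vline_q F G x = vline F x * map_poly cnj (vline G x)"

definition ind_edge :: "'a::linordered_field \<Rightarrow> 'a \<Rightarrow> 'a cplx poly \<Rightarrow> 'a" where
  "ind_edge a b H = ind_between a b (map_poly re H) (map_poly im H)"

text \<open>w(F/G | \<partial>\<Gamma>) := w(F * conj G | \<partial>\<Gamma>), for \<Gamma> = [x0,x1] \<times> [y0,y1].\<close>

definition wind_rect ::
  "'a::linordered_field cplx poly \<Rightarrow> 'a cplx poly \<Rightarrow> 'a \<Rightarrow> 'a \<Rightarrow> 'a \<Rightarrow> 'a \<Rightarrow> 'a" where
  "wind_rect F G x0 x1 y0 y1 =
     (ind_edge x0 x1 (hline_q F G y0) + ind_edge y0 y1 (vline_q F G x1)
      + ind_edge x1 x0 (hline_q F G y1) + ind_edge y1 y0 (vline_q F G x0)) / 2"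

definition val_c :: "'a::linordered_field cplx poly \<Rightarrow> 'a cplx poly \<Rightarrow> 'a cplx \<Rightarrow> int" where
  "val_c F G z = int (order z F) - int (order z G)"

definition in_rect :: "'a::linordered_field \<Rightarrow> 'a \<Rightarrow> 'a \<Rightarrow> 'a \<Rightarrow> 'a cplx \<Rightarrow> bool" where
  "in_rect x0 x1 y0 y1 z \<longleftrightarrow> x0 \<le> re z \<and> re z \<le> x1 \<and> y0 \<le> im z \<and> im z \<le> y1"

definition in_interior :: "'a::linordered_field \<Rightarrow> 'a \<Rightarrow> 'a \<Rightarrow> 'a \<Rightarrow> 'a cplx \<Rightarrow> bool" where
  "in_interior x0 x1 y0 y1 z \<longleftrightarrow> x0 < re z \<and> re z < x1 \<and> y0 < im z \<and> im z < y1"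

text \<open>c_\<Gamma>(z): 1 in the interior, 1/2 on the boundary (vertices are excluded by hypothesis).\<close>

definition c_rect :: "'a::linordered_field \<Rightarrow> 'a \<Rightarrow> 'a \<Rightarrow> 'a \<Rightarrow> 'a cplx \<Rightarrow> 'a" where
  "c_rect x0 x1 y0 y1 z = (if in_interior x0 x1 y0 y1 z then 1 else 1 / 2)"

end

theory Submission
  imports "HOL-Algebra.Algebraic_Closure_Type" Defs
begin

text \<open>
  Each edge index behaves like a change of argument divided by \<open>\<pi>\<close>, up to a term depending only on
  the endpoint values. Hence it is additive in products up to the correction
  \<open>corr z w = sgn (im z * im w * im (z * w))\<close> at the two endpoints. Locally this is a case analysis on
  one-sided signs; globally the one-sided signs of \<open>im h * im k * im (h * k)\<close> telescope by the
  intermediate value property. Around the rectangle the corrections at the corners cancel, so the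
  winding number is additive and it suffices to treat a single factor \<open>Z - z\<close>. That \<open>F\<close> and \<open>G\<close>
  split into such factors is the fundamental theorem of algebra, obtained by Laplace's argument inside
  an algebraic closure of the real closed field, with Newton's identities replacing the theorem on
  symmetric polynomials. Common zeros at the corners are cancelled beforehand.
\<close>

section \<open>Ring homomorphisms acting on coefficients\<close>

lemma map_poly_hom_mult:
  fixes h :: "'a::comm_semiring_1 \<Rightarrow> 'b::comm_semiring_1"
  assumes "h 0 = 0" and add: "\<And>x y. h (x + y) = h x + h y" and "\<And>x y. h (x * y) = h x * h y"
  shows "map_poly h (p * q) = map_poly h p * map_poly h q"
proof (rule poly_eqI)
  fix n
  have hsum: "h (sum f A) = (\<Sum>i\<in>A. h (f i))" for f and A :: "nat set"
    by (induction A rule: infinite_finite_induct) (auto simp: assms)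
  show "poly.coeff (map_poly h (p * q)) n = poly.coeff (map_poly h p * map_poly h q) n"
    by (simp add: coeff_map_poly coeff_mult assms hsum)
qed

lemma poly_map_poly_hom:
  fixes h :: "'a::comm_semiring_1 \<Rightarrow> 'b::comm_semiring_1"
  assumes "h 0 = 0" and "\<And>x y. h (x + y) = h x + h y" and "\<And>x y. h (x * y) = h x * h y"
  shows "poly (map_poly h p) (h x) = h (poly p x)"
  by (induction p) (auto simp: map_poly_pCons assms)

section \<open>Newton's identities\<close>

text \<open>Instantiated with the images of the real closed field and of \<open>cplx\<close> in the
  algebraic closure. \<open>divide_mem\<close> can cover every \<open>y\<close> because
  \<open>x / 0 = 0\<close>.\<close>

locale subfield_set =
  fixes S :: "'a::field_char_0 set"
  assumes one_mem: "1 \<in> S"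
    and diff_mem: "x \<in> S \<Longrightarrow> y \<in> S \<Longrightarrow> x - y \<in> S"
    and mult_mem: "x \<in> S \<Longrightarrow> y \<in> S \<Longrightarrow> x * y \<in> S"
    and divide_mem: "x \<in> S \<Longrightarrow> y \<in> S \<Longrightarrow> x / y \<in> S"
begin

lemma zero_mem: "0 \<in> S"
  using diff_mem[OF one_mem one_mem] by simp

lemma uminus_mem: "x \<in> S \<Longrightarrow> - x \<in> S"
  using diff_mem[OF zero_mem, of x] by simp

lemma add_mem: "x \<in> S \<Longrightarrow> y \<in> S \<Longrightarrow> x + y \<in> S"
  using diff_mem[OF _ uminus_mem, of x y] by simp

lemma sum_mem: "(\<And>i. i \<in> A \<Longrightarrow> f i \<in> S) \<Longrightarrow> sum f A \<in> S"
  by (induction A rule: infinite_finite_induct) (auto intro: zero_mem add_mem)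

lemma of_nat_mem: "of_nat n \<in> S"
  by (induction n) (auto intro: zero_mem one_mem add_mem)

lemma power_mem: "x \<in> S \<Longrightarrow> x ^ n \<in> S"
  by (induction n) (auto intro: one_mem mult_mem)

end

text \<open>Logarithmic derivative: each factor contributes \<open>- r / (1 - r X)\<close>, a
  geometric series, so derivative over product is minus the generating function of the power
  sums.\<close>

lemma fps_deriv_prod_linear:
  fixes r :: "'i \<Rightarrow> 'a::field"
  assumes "finite I"
  shows "fps_deriv (\<Prod>i\<in>I. 1 - fps_const (r i) * fps_X) =
    - (\<Prod>i\<in>I. 1 - fps_const (r i) * fps_X) * Abs_fps (\<lambda>n. \<Sum>i\<in>I. r i ^ Suc n)"
  using assms
proof (induction I)
  case empty
  show ?case by (simp add: fps_eq_iff)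
next
  case (insert j I)
  define B where "B = (\<Prod>i\<in>I. 1 - fps_const (r i) * fps_X)"
  define N where "N = Abs_fps (\<lambda>n. \<Sum>i\<in>I. r i ^ Suc n)"
  define R where "R = Abs_fps (\<lambda>n. r j ^ Suc n)"
  have geometric: "(1 - fps_const (r j) * fps_X) * R = fps_const (r j)"
  proof (rule fps_ext)
    fix n
    show "((1 - fps_const (r j) * fps_X) * R) $ n = fps_const (r j) $ n"
      by (cases n) (simp_all add: R_def left_diff_distrib mult.assoc)
  qed
  have split: "Abs_fps (\<lambda>n. \<Sum>i\<in>insert j I. r i ^ Suc n) = N + R"
    using insert.hyps by (simp add: fps_eq_iff N_def R_def)
  have deriv: "fps_deriv (1 - fps_const (r j) * fps_X) = - fps_const (r j)"
    by simp
  have "fps_deriv ((1 - fps_const (r j) * fps_X) * B)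
      = (1 - fps_const (r j) * fps_X) * (- B * N) + - fps_const (r j) * B"
    unfolding fps_deriv_mult deriv using insert.IH by (simp only: B_def N_def)
  also have "\<dots> = - ((1 - fps_const (r j) * fps_X) * B) * (N + R)"
  proof -
    \<comment> \<open>By \<open>geometric\<close>, the constant \<open>r j\<close> is
      \<open>L * R\<close> for the linear factor \<open>L\<close>; written this way the claim is an
      identity of commutative rings.\<close>
    have "L * (- B * N) + - (L * R) * B = - (L * B) * (N + R)" for L
      by (simp add: algebra_simps)
    from this[of "1 - fps_const (r j) * fps_X"] show ?thesis
      by (simp only: geometric)
  qed
  finally show ?case
    unfolding split using insert.hyps by (simp only: prod.insert B_def not_False_eq_True)
qed

lemma fps_prod_linear_nth_0: "(\<Prod>i\<in>I. 1 - fps_const (r i) * fps_X) $ 0 = (1 :: 'a::field)"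
  by (induction I rule: infinite_finite_induct) auto

text \<open>Coefficient of \<open>X ^ n\<close> in the logarithmic derivative; \<open>b k\<close> is
  the \<open>k\<close>-th elementary symmetric function of \<open>r\<close> up to the sign
  \<open>(-1) ^ k\<close>.\<close>

lemma newton_identity:
  fixes r :: "'i \<Rightarrow> 'a::field"
  assumes "finite I"
  defines "b \<equiv> fps_nth (\<Prod>i\<in>I. 1 - fps_const (r i) * fps_X)"
  shows "of_nat (Suc n) * b (Suc n) = - (\<Sum>k\<le>n. b k * (\<Sum>i\<in>I. r i ^ Suc (n - k)))"
proof -
  have "of_nat (Suc n) * b (Suc n) = fps_deriv (\<Prod>i\<in>I. 1 - fps_const (r i) * fps_X) $ n"
    by (simp add: b_def)
  also have "\<dots> = - (\<Sum>k\<le>n. b k * (\<Sum>i\<in>I. r i ^ Suc (n - k)))"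
    unfolding fps_deriv_prod_linear[OF assms(1)]
    by (simp add: fps_mult_nth b_def atMost_atLeast0 sum_negf)
  finally show ?thesis .
qed

context subfield_set
begin

text \<open>As the constant coefficient is 1, Newton's identity can be solved for the highest power
  sum without division.\<close>

lemma power_sums_mem:
  fixes r :: "'i \<Rightarrow> 'a"
  assumes I: "finite I" and b: "\<And>n. (\<Prod>i\<in>I. 1 - fps_const (r i) * fps_X) $ n \<in> S"
  shows "(\<Sum>i\<in>I. r i ^ n) \<in> S"
proof (induction n rule: less_induct)
  case (less n)
  show ?case
  proof (cases n)
    case 0
    then show ?thesis by (simp add: of_nat_mem)
  next
    case (Suc m)
    define c where "c = fps_nth (\<Prod>i\<in>I. 1 - fps_const (r i) * fps_X)"
    have c0: "c 0 = 1"
      by (simp add: c_def fps_prod_linear_nth_0)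
    have "(\<Sum>k\<le>m. c k * (\<Sum>i\<in>I. r i ^ Suc (m - k)))
        = c 0 * (\<Sum>i\<in>I. r i ^ Suc m) + (\<Sum>k\<in>{0<..m}. c k * (\<Sum>i\<in>I. r i ^ Suc (m - k)))"
      by (simp add: atMost_atLeast0 sum.head)
    moreover have "of_nat (Suc m) * c (Suc m) = - (\<Sum>k\<le>m. c k * (\<Sum>i\<in>I. r i ^ Suc (m - k)))"
      unfolding c_def by (rule newton_identity[OF I])
    ultimately have "(\<Sum>i\<in>I. r i ^ Suc m)
        = - (of_nat (Suc m) * c (Suc m)) - (\<Sum>k\<in>{0<..m}. c k * (\<Sum>i\<in>I. r i ^ Suc (m - k)))"
      by (simp only: c0) simp
    also have "\<dots> \<in> S"
      using b by (intro diff_mem uminus_mem mult_mem of_nat_mem sum_mem less.IH)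
        (auto simp: Suc c_def)
    finally show ?thesis by (simp add: Suc)
  qed
qed

text \<open>Newton's identity solved for the highest coefficient; dividing by \<open>Suc m\<close>
  is where characteristic 0 enters.\<close>

lemma coeffs_mem_if_power_sums_mem:
  fixes r :: "'i \<Rightarrow> 'a"
  assumes I: "finite I" and p: "\<And>n. (\<Sum>i\<in>I. r i ^ n) \<in> S"
  shows "(\<Prod>i\<in>I. 1 - fps_const (r i) * fps_X) $ n \<in> S"
proof (induction n rule: less_induct)
  case (less n)
  show ?case
  proof (cases n)
    case 0
    then show ?thesis by (simp add: fps_prod_linear_nth_0 one_mem)
  next
    case (Suc m)
    define c where "c = fps_nth (\<Prod>i\<in>I. 1 - fps_const (r i) * fps_X)"
    define T where "T = - (\<Sum>k\<le>m. c k * (\<Sum>i\<in>I. r i ^ Suc (m - k)))"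
    have "of_nat (Suc m) * c (Suc m) = T"
      unfolding c_def T_def by (rule newton_identity[OF I])
    then have "c (Suc m) = T / of_nat (Suc m)"
      by (metis eq_divide_imp mult.commute of_nat_neq_0)
    also have "\<dots> \<in> S"
      unfolding T_def by (intro divide_mem uminus_mem sum_mem mult_mem of_nat_mem p)
        (auto simp: Suc c_def intro: less.IH)
    finally show ?thesis by (simp add: Suc c_def)
  qed
qed

end

text \<open>Reversing coefficients turns \<open>X - r\<close> into \<open>1 - r X\<close>, which
  links Newton's identities to the polynomial with roots \<open>r i\<close>.\<close>

lemma reflect_poly_prod_linear:
  fixes r :: "'i \<Rightarrow> 'a::field"
  shows "fps_of_poly (reflect_poly (\<Prod>i\<in>I. [:- r i, 1:])) = (\<Prod>i\<in>I. 1 - fps_const (r i) * fps_X)"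
proof -
  have "reflect_poly [:- a, 1:] = [:1, - a:]" for a :: 'a
    by (simp add: reflect_poly_def)
  moreover have "fps_of_poly [:1, - a:] = 1 - fps_const a * fps_X" for a :: 'a
  proof (rule fps_ext)
    fix n
    show "fps_of_poly [:1, - a:] $ n = (1 - fps_const a * fps_X) $ n"
      by (cases n; cases "n - 1") (auto simp: coeff_pCons split: nat.split)
  qed
  ultimately show ?thesis
    by (simp only: reflect_poly_prod fps_of_poly_prod)
qed

context subfield_set
begin

text \<open>Stands in for the theorem on symmetric polynomials: power sums are easy to compute for
  roots that are built from other roots, and they decide membership of the coefficients.\<close>

lemma coeff_prod_linear_mem_iff:
  fixes r :: "'i \<Rightarrow> 'a"
  assumes "finite I"
  shows "(\<forall>n. poly.coeff (\<Prod>i\<in>I. [:- r i, 1:]) n \<in> S) \<longleftrightarrow> (\<forall>n. (\<Sum>i\<in>I. r i ^ n) \<in> S)"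
proof -
  define A where "A = (\<Prod>i\<in>I. [:- r i, 1:])"
  have nth: "(\<Prod>i\<in>I. 1 - fps_const (r i) * fps_X) $ n = poly.coeff (reflect_poly A) n" for n
    by (simp add: reflect_poly_prod_linear[symmetric] A_def)
  have "(\<forall>n. poly.coeff A n \<in> S) \<longleftrightarrow> (\<forall>n. poly.coeff (reflect_poly A) n \<in> S)"
  proof (intro iffI allI)
    fix n assume "\<forall>n. poly.coeff A n \<in> S"
    then show "poly.coeff (reflect_poly A) n \<in> S"
      by (auto simp: coeff_reflect_poly zero_mem)
  next
    fix n assume *: "\<forall>n. poly.coeff (reflect_poly A) n \<in> S"
    show "poly.coeff A n \<in> S"
    proof (cases "n \<le> degree A")
      case True
      then show ?thesis using *[rule_format, of "degree A - n"]
        by (simp add: coeff_reflect_poly split: if_splits)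
    qed (simp add: coeff_eq_0 zero_mem)
  qed
  then show ?thesis
    using power_sums_mem[OF assms, of r] coeffs_mem_if_power_sums_mem[OF assms, of r]
    unfolding nth A_def by blast
qed

(* The power sums of a symmetric expression over pairs i < j are polynomials in the power sums of a. *)
lemma pair_power_sum_mem:
  fixes a :: "nat \<Rightarrow> 'a"
  assumes a: "\<And>k. (\<Sum>i<n. a i ^ k) \<in> S" and c: "c \<in> S"
  shows "(\<Sum>(i, j)\<in>{(i, j). i < j \<and> j < n}. (a i + a j + c * a i * a j) ^ m) \<in> S"
proof -
  define f where "f = (\<lambda>(i, j). (a i + a j + c * a i * a j) ^ m)"
  define L where "L = {(i, j). i < j \<and> j < n}"
  define U where "U = {(i, j). j < i \<and> i < n}"
  define D where "D = (\<lambda>i. (i, i)) ` {..<n}"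
  have fin: "finite L" "finite U" "finite D"
    by (rule finite_subset[of _ "{..<n} \<times> {..<n}"]; force simp: L_def U_def D_def)+
  have moment: "(\<Sum>i<n. \<Sum>j<n. a i ^ s * a j ^ t) \<in> S" for s t
    unfolding sum_product[symmetric] by (intro mult_mem a)
  \<comment> \<open>Index set of a double binomial expansion: \<open>k\<close> is the exponent of
    \<open>x + y\<close> and \<open>l\<close> that of \<open>x\<close> inside it; \<open>w\<close>
    is the coefficient, \<open>s\<close> and \<open>t\<close> are the total exponents of
    \<open>x\<close> and \<open>y\<close>.\<close>
  define M where "M = (SIGMA k:{..m}. {..k})"
  define w where "w = (\<lambda>(k, l). of_nat (m choose k) * of_nat (k choose l) * c ^ (m - k))"
  define s t where "s = (\<lambda>(k, l). l + (m - k))" and "t = (\<lambda>(k, l). (k - l) + (m - k))"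
  have w: "w p \<in> S" for p
    by (auto simp: w_def split: prod.split intro!: mult_mem of_nat_mem power_mem c)
  have expand: "(x + y + c * x * y) ^ m = (\<Sum>p\<in>M. w p * (x ^ s p * y ^ t p))" for x y
  proof -
    have inner: "of_nat b * (x + y) ^ k * (c * x * y) ^ e
        = (\<Sum>l\<le>k. of_nat b * of_nat (k choose l) * c ^ e * (x ^ (l + e) * y ^ ((k - l) + e)))" for b k e
      unfolding binomial_ring sum_distrib_right sum_distrib_left
      by (intro sum.cong refl) (simp only: power_mult_distrib power_add mult_ac)
    have "(x + y + c * x * y) ^ m = (\<Sum>k\<le>m. of_nat (m choose k) * (x + y) ^ k * (c * x * y) ^ (m - k))"
      by (rule binomial_ring)
    also have "\<dots> = (\<Sum>p\<in>M. w p * (x ^ s p * y ^ t p))"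
      unfolding inner M_def w_def s_def t_def by (subst sum.Sigma) (auto simp: case_prod_unfold)
    finally show ?thesis .
  qed
  have "(\<Sum>i<n. \<Sum>j<n. f (i, j)) = (\<Sum>i<n. \<Sum>p\<in>M. \<Sum>j<n. w p * (a i ^ s p * a j ^ t p))"
    unfolding f_def prod.case expand by (intro sum.cong refl sum.swap)
  also have "\<dots> = (\<Sum>p\<in>M. w p * (\<Sum>i<n. \<Sum>j<n. a i ^ s p * a j ^ t p))"
    unfolding sum_distrib_left by (rule sum.swap)
  also have "\<dots> \<in> S"
    by (intro sum_mem mult_mem w moment)
  finally have total: "(\<Sum>i<n. \<Sum>j<n. f (i, j)) \<in> S" .
  have "(\<Sum>i<n. f (i, i)) = (\<Sum>p\<in>M. w p * (\<Sum>i<n. a i ^ (s p + t p)))"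
    unfolding f_def prod.case expand sum_distrib_left power_add by (rule sum.swap)
  also have "\<dots> \<in> S"
    by (intro sum_mem mult_mem w a)
  finally have diag: "(\<Sum>i<n. f (i, i)) \<in> S" .
  \<comment> \<open>\<open>f\<close> is symmetric, so the sum over the square is twice the sum over
    \<open>L\<close> plus the diagonal.\<close>
  have "{..<n} \<times> {..<n} = L \<union> U \<union> D"
    by (auto simp: L_def U_def D_def)
  moreover have "L \<inter> U = {}" "(L \<union> U) \<inter> D = {}"
    by (auto simp: L_def U_def D_def)
  ultimately have "(\<Sum>i<n. \<Sum>j<n. f (i, j)) = sum f L + sum f U + sum f D"
    using fin by (simp add: sum.cartesian_product sum.union_disjoint)
  moreover have "sum f D = (\<Sum>i<n. f (i, i))"
    by (simp add: D_def sum.reindex inj_on_def)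
  moreover have "sum f U = sum f L"
    by (rule sum.reindex_bij_witness[of _ prod.swap prod.swap])
      (auto simp: L_def U_def f_def add_ac mult_ac)
  ultimately have "sum f L = ((\<Sum>i<n. \<Sum>j<n. f (i, j)) - (\<Sum>i<n. f (i, i))) / of_nat 2"
    by simp
  also have "\<dots> \<in> S"
    by (intro divide_mem diff_mem total diag of_nat_mem)
  finally show ?thesis by (simp add: L_def f_def)
qed

end

section \<open>The fundamental theorem of algebra over a real closed field\<close>

lemma re_im_simps [simp]:
  "re 0 = 0" "im 0 = 0" "re 1 = 1" "im 1 = 0"
  "re (z + w) = re z + re w" "im (z + w) = im z + im w"
  "re (z - w) = re z - re w" "im (z - w) = im z - im w"
  "re (- z) = - re z" "im (- z) = - im z"
  "re (z * w) = re z * re w - im z * im w" "im (z * w) = re z * im w + im z * re w"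
  "re (cnj z) = re z" "im (cnj z) = - im z"
  by (simp_all add: zero_cplx_def one_cplx_def plus_cplx_def minus_cplx_def uminus_cplx_def
      times_cplx_def cnj_def)

definition of_re :: "'a::linordered_field \<Rightarrow> 'a cplx" where
  "of_re x = Cplx x 0"

lemma re_of_re [simp]: "re (of_re x) = x" and im_of_re [simp]: "im (of_re x) = 0"
  by (simp_all add: of_re_def)

lemma of_re_simps [simp]:
  "of_re 0 = 0" "of_re 1 = 1" "of_re (x + y) = of_re x + of_re y"
  "of_re (x * y) = of_re x * of_re y" "of_re (- x) = - of_re x" "of_re x = of_re y \<longleftrightarrow> x = y"
  by (simp_all add: cplx_eq_iff)

lemma cnj_simps [simp]:
  "cnj 0 = 0" "cnj 1 = 1" "cnj (z + w) = cnj z + cnj w" "cnj (z * w) = cnj z * cnj w"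
  "cnj (- z) = - cnj z" "cnj (cnj z) = z" "cnj (of_re x) = of_re x" "cnj z = 0 \<longleftrightarrow> z = 0"
  by (auto simp: cplx_eq_iff)

lemma map_poly_cnj_mult: "map_poly cnj (p * q) = map_poly cnj p * map_poly cnj q"
  by (rule map_poly_hom_mult) simp_all

lemma poly_map_poly_cnj: "poly (map_poly cnj p) (cnj z) = cnj (poly p z)"
  by (rule poly_map_poly_hom) simp_all

text \<open>The product is fixed by conjugation, so its coefficients are real.\<close>

lemma mult_cnj_real: "\<exists>r. p * map_poly cnj p = map_poly of_re r"
proof -
  define q where "q = p * map_poly cnj p"
  have "map_poly cnj (map_poly cnj p) = p"
    by (simp add: map_poly_map_poly o_def)
  then have "map_poly cnj q = q"
    by (simp add: q_def map_poly_cnj_mult)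
  then have "cnj (poly.coeff q n) = poly.coeff q n" for n
    by (metis coeff_map_poly cnj_simps(1))
  then have "im (poly.coeff q n) = 0" for n
    by (simp add: cplx_eq_iff)
  then have "q = map_poly of_re (map_poly re q)"
    by (intro poly_eqI) (simp add: coeff_map_poly cplx_eq_iff)
  then show ?thesis unfolding q_def by blast
qed

text \<open>Half-angle formulas: with \<open>r\<close> the modulus, the squares of the two parts of
  a root are \<open>(r + x) / 2\<close> and \<open>(r - x) / 2\<close>; the sign of \<open>v\<close>
  is adapted to \<open>y\<close>.\<close>

lemma cplx_sqrt_exists:
  fixes z :: "'a::real_closed_field cplx"
  shows "\<exists>w. w * w = z"
proof -
  define x y where "x = re z" and "y = im z"
  obtain r0 where "r0 * r0 = x * x + y * y"
    using nonneg_is_square[of "x * x + y * y"] by auto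
  then have r: "\<bar>r0\<bar> * \<bar>r0\<bar> = x * x + y * y"
    by simp
  define r where "r = \<bar>r0\<bar>"
  have "x * x \<le> r * r"
    using r by (simp add: r_def)
  then have "\<bar>x\<bar> \<le> r"
    using abs_le_square_iff[of x r] by (simp add: power2_eq_square r_def)
  then have "0 \<le> (r + x) / 2" "0 \<le> (r - x) / 2"
    by auto
  then obtain u v where u: "u * u = (r + x) / 2" and v: "v * v = (r - x) / 2"
    using nonneg_is_square by metis
  have "(2 * u * v) * (2 * u * v) = 4 * (u * u) * (v * v)"
    by (simp add: algebra_simps)
  also have "\<dots> = r * r - x * x"
    by (simp add: u v field_simps)
  also have "\<dots> = y * y"
    using r by (simp add: r_def)
  finally have "2 * u * v = y \<or> 2 * u * v = - y"
    using square_eq_iff by blast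
  then have "Cplx u v * Cplx u v = z \<or> Cplx u (- v) * Cplx u (- v) = z"
    using u v by (auto simp: cplx_eq_iff x_def y_def field_simps)
  then show ?thesis by blast
qed

(* By induction on the 2-adic valuation of the degree: the sums a i + a j + c * a i * a j over pairs of
   roots are the roots of a real polynomial of smaller 2-adic valuation, and two values of c that hit the
   same pair give a i as the root of a quadratic over the complex numbers. *)
lemma real_poly_has_cplx_root:
  fixes p :: "'a::real_closed_field poly"
  assumes "degree p = 2 ^ k * m" and "odd m"
  shows "\<exists>z. poly (map_poly of_re p) z = 0"
  using assms
proof (induction k arbitrary: p m)
  case 0
  then have "odd (degree p)" by simp
  then have "poly.coeff p (degree p) \<noteq> 0" by auto
  then obtain x where "(\<Sum>i\<le>degree p. poly.coeff p i * x ^ i) = 0"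
    using odd_degree_root[OF \<open>odd (degree p)\<close>, of "poly.coeff p"] by blast
  then have "poly (map_poly of_re p) (of_re x) = 0"
    by (subst poly_map_poly_hom) (simp_all add: poly_altdef)
  then show ?case by blast
next
  case (Suc k)
  define n where "n = degree p"
  \<comment> \<open>\<open>P\<close> splits in the algebraic closure, and \<open>a\<close> will list
    its roots with multiplicity.\<close>
  define P where "P = map_poly to_ac p"
  have "n > 0"
    using Suc.prems by (auto simp: n_def intro!: Nat.gr0I)
  have "p \<noteq> 0"
    using \<open>n > 0\<close> by (auto simp: n_def)
  have "P \<noteq> 0" and degP: "degree P = n"
    using \<open>p \<noteq> 0\<close> by (auto simp: P_def n_def map_poly_eq_0_iff degree_map_poly)
  obtain A where A: "size A = n" "P = smult (lead_coeff P) (\<Prod>x\<in>#A. [:-x, 1:])"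
    using alg_closed_imp_factorization[OF \<open>P \<noteq> 0\<close>] degP by auto
  obtain xs where xs: "A = mset xs"
    using ex_mset[of A] by auto
  define a where "a i = xs ! i" for i
  have len: "length xs = n"
    using A xs by simp
  have "(\<Prod>x\<in>#A. [:-x, 1:]) = prod_list (map (\<lambda>x. [:-x, 1:]) xs)"
    by (simp add: xs prod_mset_prod_list[symmetric])
  also have "\<dots> = (\<Prod>i<n. [:- a i, 1:])"
    by (simp add: prod.list_conv_set_nth len a_def atLeast0LessThan)
  finally have fact: "P = smult (lead_coeff P) (\<Prod>i<n. [:- a i, 1:])"
    using A by simp
  have coeffP: "poly.coeff P j \<in> range to_ac" for j
    by (simp add: P_def coeff_map_poly)
  have lcP: "lead_coeff P \<noteq> 0"
    using \<open>P \<noteq> 0\<close> by simp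
  interpret R: subfield_set "range (to_ac :: 'a \<Rightarrow> 'a alg_closure)"
  proof
    show "1 \<in> range (to_ac :: 'a \<Rightarrow> 'a alg_closure)"
      by (metis rangeI to_ac_1)
  qed (auto simp flip: to_ac_diff to_ac_mult to_ac_divide)
  have "poly.coeff (\<Prod>i<n. [:- a i, 1:]) j \<in> range to_ac" for j
  proof -
    have "poly.coeff (\<Prod>i<n. [:- a i, 1:]) j = poly.coeff P j / lead_coeff P"
      using lcP by (subst fact) (simp add: degP)
    also have "\<dots> \<in> range to_ac"
      by (intro R.divide_mem coeffP)
    finally show ?thesis .
  qed
  then have moments: "(\<Sum>i<n. a i ^ j) \<in> range to_ac" for j
    using R.coeff_prod_linear_mem_iff[of "{..<n}" a] by simp
  \<comment> \<open>A square root of \<open>-1\<close> in the closure yields the embedding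
    \<open>emb\<close> of \<open>cplx\<close>; the goal is a root \<open>a i\<close> in its
    range.\<close>
  obtain \<iota> :: "'a alg_closure" where \<iota>: "\<iota> ^ 2 = - 1"
    using nth_root_exists[of 2 "-1 :: 'a alg_closure"] by auto
  define emb where "emb z = to_ac (re z) + to_ac (im z) * \<iota>" for z :: "'a cplx"
  have emb_simps: "emb 0 = 0" "emb (z + w) = emb z + emb w" "emb (- z) = - emb z"
    "emb (z - w) = emb z - emb w" "emb (of_re x) = to_ac x" "emb 1 = 1" for z w x
    by (simp_all add: emb_def algebra_simps)
  have \<iota>_\<iota>: "\<iota> * (\<iota> * t) = - t" for t
    using \<iota> by (simp add: mult.assoc[symmetric] power2_eq_square)
  have emb_mult: "emb (z * w) = emb z * emb w" for z w
    by (simp add: emb_def algebra_simps \<iota>_\<iota>)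
  have emb_0_iff: "emb z = 0 \<longleftrightarrow> z = 0" for z
  proof
    assume "emb z = 0"
    show "z = 0"
    proof (rule ccontr)
      assume "z \<noteq> 0"
      then have "emb z * emb (inverse z) = 1"
        by (simp flip: emb_mult add: emb_simps)
      then show False using \<open>emb z = 0\<close> by simp
    qed
  qed (simp add: emb_simps)
  have emb_inverse: "emb (inverse z) = inverse (emb z)" for z
  proof (cases "z = 0")
    case False
    then have "emb z * emb (inverse z) = 1"
      by (simp flip: emb_mult add: emb_simps)
    then show ?thesis by (simp add: inverse_unique)
  qed (simp add: emb_simps)
  have emb_divide: "emb (z / w) = emb z / emb w" for z w
    by (simp add: divide_inverse emb_mult emb_inverse)
  interpret E: subfield_set "range emb"
  proof
    show "1 \<in> range emb" by (metis rangeI emb_simps(6))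
  qed (auto simp flip: emb_simps emb_mult emb_divide)
  have poly_emb: "poly (map_poly to_ac q) (emb z) = emb (poly (map_poly of_re q) z)" for q z
  proof -
    have "map_poly to_ac q = map_poly emb (map_poly of_re q)"
      by (simp add: map_poly_map_poly o_def emb_simps)
    then show ?thesis by (simp add: poly_map_poly_hom emb_simps emb_mult)
  qed
  define I where "I = {(i, j). i < j \<and> j < n}"
  have finI: "finite I"
    by (rule finite_subset[of _ "{..<n} \<times> {..<n}"]) (auto simp: I_def)
  \<comment> \<open>There are \<open>n * (n - 1) / 2\<close> pairs. Since \<open>n\<close> is even,
    \<open>n - 1\<close> is odd, so exactly one factor 2 is lost.\<close>
  have "card I = 2 ^ k * (m * (n - 1))"
  proof -
    have "I = prod.swap ` (SIGMA j:{..<n}. {..<j})"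
      by (auto simp: I_def image_iff)
    then have "card I = card (SIGMA j:{..<n}. {..<j})"
      by (simp add: card_image)
    then have "card I = \<Sum>{..<n}"
      by simp
    moreover have "2 * \<Sum>{..<l} + l = l * l" for l :: nat
      by (induction l) auto
    ultimately have "2 * card I + n = n * n"
      by simp
    then have "2 * card I = n * (n - 1)"
      by (simp add: diff_mult_distrib2)
    then show ?thesis
      using Suc.prems by (simp add: n_def)
  qed
  moreover have "odd (m * (n - 1))"
    using Suc.prems \<open>n > 0\<close> by (simp add: n_def)
  ultimately have cardI: "card I = 2 ^ k * (m * (n - 1))" "odd (m * (n - 1))" .
  have ex: "\<exists>ij\<in>I. a (fst ij) + a (snd ij) + of_nat c * a (fst ij) * a (snd ij) \<in> range emb" for c :: nat
  proof -
    define r where "r = (\<lambda>(i, j). a i + a j + of_nat c * a i * a j)"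
    define Q where "Q = (\<Prod>ij\<in>I. [:- r ij, 1:])"
    have "(\<Sum>ij\<in>I. r ij ^ t) \<in> range to_ac" for t
      using R.pair_power_sum_mem[OF moments R.of_nat_mem]
      by (simp add: I_def r_def case_prod_unfold)
    then have "poly.coeff Q t \<in> range to_ac" for t
      using R.coeff_prod_linear_mem_iff[OF finI, of r] by (simp add: Q_def)
    \<comment> \<open>The coefficients of \<open>Q\<close> come from the base field, so
      \<open>Q\<close> descends to a real polynomial for the induction hypothesis.\<close>
    then have Q: "map_poly to_ac (map_poly of_ac Q) = Q"
      by (intro poly_eqI) (simp add: coeff_map_poly to_ac_of_ac)
    have "degree Q = card I"
      unfolding Q_def by (subst degree_prod_eq_sum_degree) auto
    then have "degree (map_poly of_ac Q) = card I"
      by (metis Q degree_map_poly to_ac_eq_0_iff)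
    then obtain z where "poly (map_poly of_re (map_poly of_ac Q)) z = 0"
      using Suc.IH cardI by metis
    then have "poly Q (emb z) = 0"
      using poly_emb[of "map_poly of_ac Q" z] by (simp add: Q emb_simps)
    then obtain ij where "ij \<in> I" "r ij = emb z"
      using finI by (auto simp: Q_def poly_prod)
    then show ?thesis
      by (intro bexI[of _ ij]) (simp_all add: r_def case_prod_unfold)
  qed
  then obtain pr where pr: "\<And>c. pr c \<in> I"
    "\<And>c :: nat. a (fst (pr c)) + a (snd (pr c)) + of_nat c * a (fst (pr c)) * a (snd (pr c)) \<in> range emb"
    by metis
  \<comment> \<open>Pigeonhole: infinitely many \<open>c\<close>, finitely many pairs.\<close>
  have "\<not> inj pr"
    using finI pr(1) by (metis finite_subset image_subset_iff finite_imageD infinite_UNIV_nat)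
  then obtain c d where cd: "pr c = pr d" "c \<noteq> d"
    by (auto simp: inj_on_def)
  obtain i j where ij: "pr c = (i, j)" by (cases "pr c")
  have "i < n"
    using pr(1)[of c] ij by (auto simp: I_def)
  have c: "a i + a j + of_nat c * a i * a j \<in> range emb"
    and d: "a i + a j + of_nat d * a i * a j \<in> range emb"
    using pr(2)[of c] pr(2)[of d] unfolding cd(1)[symmetric] ij fst_conv snd_conv by simp_all
  define e :: "'a alg_closure" where "e = of_nat c - of_nat d"
  have "e \<noteq> 0" using cd by (simp add: e_def)
  have "a i * a j = ((a i + a j + of_nat c * a i * a j) - (a i + a j + of_nat d * a i * a j)) / e"
    using \<open>e \<noteq> 0\<close> by (simp add: field_simps e_def)
  also have "\<dots> \<in> range emb"
    unfolding e_def by (intro E.divide_mem E.diff_mem E.of_nat_mem c d)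
  finally have prod: "a i * a j \<in> range emb" .
  have "a i + a j = (a i + a j + of_nat c * a i * a j) - of_nat c * (a i * a j)"
    by (simp add: algebra_simps)
  also have "\<dots> \<in> range emb"
    by (intro E.diff_mem c E.mult_mem E.of_nat_mem prod)
  finally have sum: "a i + a j \<in> range emb" .
  \<comment> \<open>The discriminant of the quadratic with roots \<open>a i\<close> and
    \<open>a j\<close>.\<close>
  have "(a i - a j) * (a i - a j) = (a i + a j) * (a i + a j) - of_nat 4 * (a i * a j)"
    by (simp add: algebra_simps)
  also have "\<dots> \<in> range emb"
    by (intro E.diff_mem E.mult_mem E.of_nat_mem sum prod)
  finally obtain w where w: "(a i - a j) * (a i - a j) = emb w" by blast
  obtain v where "v * v = w" using cplx_sqrt_exists by blast
  then have "(a i - a j) * (a i - a j) = emb v * emb v"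
    using w emb_mult by metis
  then have "a i - a j = emb v \<or> a i - a j = - emb v"
    by (simp add: square_eq_iff)
  then have "a i - a j \<in> range emb"
    using E.uminus_mem[of "emb v"] by auto
  then have "((a i + a j) + (a i - a j)) / of_nat 2 \<in> range emb"
    by (intro E.divide_mem E.add_mem E.of_nat_mem sum)
  then obtain z where z: "a i = emb z" by auto
  have "poly P (a i) = 0"
    using \<open>i < n\<close> by (subst fact) (auto simp: poly_prod)
  then have "poly (map_poly of_re p) z = 0"
    unfolding P_def z poly_emb by (simp add: emb_0_iff)
  then show ?case by blast
qed

text \<open>If \<open>z\<close> is a root of the real polynomial \<open>p * map_poly cnj p\<close>,
  then \<open>z\<close> or \<open>cnj z\<close> is a root of \<open>p\<close>.\<close>

instance cplx :: (real_closed_field) alg_closed_field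
proof (rule alg_closedI)
  fix p :: "'a cplx poly"
  assume "degree p > 0"
  define q where "q = p * map_poly cnj p"
  obtain r where q: "map_poly of_re r = q"
    using mult_cnj_real unfolding q_def by metis
  have "p \<noteq> 0"
    using \<open>degree p > 0\<close> by auto
  then have "degree q = 2 * degree p"
    by (simp add: q_def degree_mult_eq map_poly_eq_0_iff degree_map_poly)
  moreover have "degree q = degree r"
    by (metis q degree_map_poly of_re_simps(1,6))
  ultimately have "degree r \<noteq> 0"
    using \<open>degree p > 0\<close> by simp
  then obtain m where "degree r = 2 ^ multiplicity 2 (degree r) * m" "odd m"
    using multiplicity_decompose'[of "degree r" 2] by auto
  then obtain z where "poly (map_poly of_re r) z = 0"
    using real_poly_has_cplx_root by blast
  then have "poly p z = 0 \<or> poly (map_poly cnj p) (cnj (cnj z)) = 0"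
    by (simp add: q q_def)
  then show "\<exists>x. poly p x = 0"
    unfolding poly_map_poly_cnj by auto
qed

section \<open>One-sided signs and the local product formula\<close>

(* The sign of P immediately to the right (e = 1) or left (e = -1) of x. *)
definition sg :: "'a::linordered_field \<Rightarrow> 'a poly \<Rightarrow> 'a \<Rightarrow> 'a" where
  "sg e P x = e ^ Polynomial.order x P * sgn (poly (cofactor P x) x)"

lemma cofactor_eqI:
  fixes P :: "'a::field poly"
  assumes "P = [:- x, 1:] ^ n * Q" and "poly Q x \<noteq> 0"
  shows "Polynomial.order x P = n" "cofactor P x = Q"
proof -
  have "Q \<noteq> 0" using assms(2) by auto
  then have "[:- x, 1:] ^ n * Q \<noteq> 0" by simp
  then have "Polynomial.order x P = Polynomial.order x ([:- x, 1:] ^ n) + Polynomial.order x Q"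
    unfolding assms(1) by (rule order_mult)
  then show n: "Polynomial.order x P = n"
    using assms(2) by (simp add: order_power_n_n order_0I)
  show "cofactor P x = Q"
    unfolding cofactor_def n using assms(1) by simp
qed

lemma cofactor_decomp:
  fixes P :: "'a::field poly"
  assumes "P \<noteq> 0"
  shows "P = [:- x, 1:] ^ Polynomial.order x P * cofactor P x" "poly (cofactor P x) x \<noteq> 0"
proof -
  obtain Q where Q: "P = [:- x, 1:] ^ Polynomial.order x P * Q" "\<not> [:- x, 1:] dvd Q"
    using order_decomp[OF assms] by blast
  then have "poly Q x \<noteq> 0" by (simp add: poly_eq_0_iff_dvd)
  then have "cofactor P x = Q" using Q(1) cofactor_eqI(2) by blast
  then show "P = [:- x, 1:] ^ Polynomial.order x P * cofactor P x" "poly (cofactor P x) x \<noteq> 0"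
    using Q \<open>poly Q x \<noteq> 0\<close> by auto
qed

lemma cofactor_0 [simp]: "cofactor 0 x = 0"
  by (simp add: cofactor_def)

lemma cofactor_mult: "cofactor (P * Q) x = cofactor P x * cofactor Q x"
proof (cases "P = 0 \<or> Q = 0")
  case False
  then have "P * Q = [:- x, 1:] ^ (Polynomial.order x P + Polynomial.order x Q) * (cofactor P x * cofactor Q x)"
    using cofactor_decomp(1)[of P x] cofactor_decomp(1)[of Q x]
    by (metis (no_types, opaque_lifting) mult.assoc mult.left_commute power_add)
  moreover have "poly (cofactor P x * cofactor Q x) x \<noteq> 0"
    using False cofactor_decomp(2)[of P x] cofactor_decomp(2)[of Q x] by simp
  ultimately show ?thesis by (rule cofactor_eqI)
qed auto

lemma sg_0 [simp]: "sg e 0 x = 0"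
  by (simp add: sg_def)

lemma sg_mult: "sg e (P * Q) x = sg e P x * sg e Q x"
proof (cases "P = 0 \<or> Q = 0")
  case False
  then have "Polynomial.order x (P * Q) = Polynomial.order x P + Polynomial.order x Q"
    by (intro order_mult) simp
  then show ?thesis
    by (simp add: sg_def cofactor_mult sgn_mult power_add mult_ac)
qed auto

lemma sg_eqI:
  assumes "P = [:- x, 1:] ^ n * Q" and "poly Q x \<noteq> 0"
  shows "sg e P x = e ^ n * sgn (poly Q x)"
  using cofactor_eqI[OF assms] by (simp add: sg_def)

lemma sg_eq_sgn: "poly P x \<noteq> 0 \<Longrightarrow> sg e P x = sgn (poly P x)"
  using sg_eqI[of P x 0 P e] by simp

lemma sg_uminus: "sg e (- P) x = - sg e P x"
  using sg_mult[of e "[:-1:]" P x] by (simp add: sg_eq_sgn)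

lemma sg_cases:
  assumes "e = 1 \<or> e = - 1"
  shows "sg e P x = 1 \<or> sg e P x = -1 \<or> P = 0"
proof (cases "P = 0")
  case False
  have "e ^ n = 1 \<or> e ^ n = -1" for n
    using assms by (induction n) auto
  moreover have "sgn (poly (cofactor P x) x) = 1 \<or> sgn (poly (cofactor P x) x) = -1"
    using cofactor_decomp(2)[OF False, of x] by (auto simp: sgn_if)
  ultimately show ?thesis
    unfolding sg_def by (metis mult_minus1 mult_minus_right mult_1 minus_minus mult.right_neutral)
qed simp

text \<open>After factoring out the power of \<open>X - x\<close> in \<open>P\<close>, the value
  left at \<open>x\<close> is that of \<open>p\<close> alone if \<open>Q\<close> has larger order,
  and otherwise a sum of two values of equal sign.\<close>

lemma sg_add_aux:
  assumes "e = 1 \<or> e = - 1" and "P \<noteq> 0" and "Q \<noteq> 0" and "sg e P x = sg e Q x"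
    and "Polynomial.order x P \<le> Polynomial.order x Q"
  shows "sg e (P + Q) x = sg e P x"
proof -
  define m d where "m = Polynomial.order x P" and "d = Polynomial.order x Q - m"
  define p q where "p = cofactor P x" and "q = cofactor Q x"
  have Q: "Polynomial.order x Q = m + d"
    using assms(5) by (simp add: m_def d_def)
  have "P = [:- x, 1:] ^ m * p" "Q = [:- x, 1:] ^ (m + d) * q"
    using cofactor_decomp(1)[OF assms(2), of x] cofactor_decomp(1)[OF assms(3), of x]
    unfolding Q by (simp_all add: m_def p_def q_def)
  then have PQ: "P + Q = [:- x, 1:] ^ m * (p + [:- x, 1:] ^ d * q)"
    by (simp add: algebra_simps power_add)
  have p: "poly p x \<noteq> 0"
    using cofactor_decomp(2)[OF assms(2)] by (simp add: p_def)
  have "sgn (poly (p + [:- x, 1:] ^ d * q) x) = sgn (poly p x)"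
  proof (cases "d = 0")
    case True
    then have "e ^ m * sgn (poly p x) = e ^ m * sgn (poly q x)"
      using assms(4) Q by (simp add: sg_def p_def q_def m_def)
    moreover have "e ^ m \<noteq> 0" using assms(1) by auto
    ultimately have "sgn (poly p x) = sgn (poly q x)"
      using mult_left_cancel by blast
    then show ?thesis
      using True p by (auto simp: sgn_if split: if_splits)
  next
    case False
    then show ?thesis by (simp add: power_0_left)
  qed
  moreover from this have "poly (p + [:- x, 1:] ^ d * q) x \<noteq> 0"
    using p by (metis sgn_0_0)
  ultimately show ?thesis
    using sg_eqI[OF PQ, of e] by (simp add: sg_def m_def p_def)
qed

lemma sg_add:
  assumes "e = 1 \<or> e = - 1" and "sg e P x = sg e Q x"
  shows "sg e (P + Q) x = sg e P x"
proof (cases "P = 0 \<or> Q = 0")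
  case True
  then show ?thesis using assms sg_cases[of e P x] sg_cases[of e Q x] by auto
next
  case False
  then show ?thesis
    using sg_add_aux[of e P Q x] sg_add_aux[of e Q P x] assms
    by (metis add.commute nat_le_linear)
qed

text \<open>Both half-indices in one formula: \<open>e = 1\<close> gives \<open>ind_plus\<close> and
  \<open>e = -1\<close> gives \<open>ind_minus\<close>. The one-sided sign of \<open>P * Q\<close>
  is that of \<open>P / Q\<close>.\<close>

definition ind :: "'a::linordered_field \<Rightarrow> 'a poly \<Rightarrow> 'a poly \<Rightarrow> 'a \<Rightarrow> 'a" where
  "ind e P Q x = (if P \<noteq> 0 \<and> Q \<noteq> 0 \<and> val_r P Q x < 0 then sg e (P * Q) x / 2 else 0)"

lemma ind_plus_eq: "ind_plus P Q x = ind 1 P Q x"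
  by (simp add: ind_plus_def ind_def sg_def cofactor_mult)

lemma ind_minus_eq: "ind_minus P Q x = ind (- 1) P Q x"
proof (cases "P \<noteq> 0 \<and> Q \<noteq> 0 \<and> val_r P Q x < 0")
  case True
  define m n where "m = Polynomial.order x P" and "n = Polynomial.order x Q"
  have "m < n" and "nat (- val_r P Q x) = n - m"
    using True by (auto simp: val_r_def m_def n_def)
  \<comment> \<open>The exponents differ by \<open>2 * m\<close>, so the sign in \<open>sg\<close>
    agrees with the one given by the valuation.\<close>
  moreover have "(- 1 :: 'a) ^ (m + n) = (- 1) ^ (n - m)"
    using \<open>m < n\<close> by (simp add: minus_one_power_iff)
  moreover have "Polynomial.order x (P * Q) = m + n"
    using True by (simp add: order_mult m_def n_def)
  ultimately show ?thesis
    using True by (simp add: ind_minus_def ind_def sg_def cofactor_mult)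
qed (auto simp: ind_minus_def ind_def)

lemma ind_scale:
  assumes "R \<noteq> 0" and "e = 1 \<or> e = - 1"
  shows "ind e (R * P) (R * Q) x = ind e P Q x"
proof (cases "P = 0 \<or> Q = 0")
  case False
  have "val_r (R * P) (R * Q) x = val_r P Q x"
    using assms(1) False by (simp add: val_r_def order_mult)
  moreover have "sg e (R * P * (R * Q)) x = sg e (P * Q) x"
    using sg_cases[OF assms(2), of R x] assms(1) by (auto simp: sg_mult)
  ultimately show ?thesis using assms(1) by (simp add: ind_def)
qed (auto simp: ind_def)

lemma ind_uminus: "ind e P (- Q) x = - ind e P Q x"
  by (simp add: ind_def val_r_def sg_uminus)

text \<open>Without a common zero at \<open>x\<close>, a pole of \<open>P / Q\<close> is just a zero
  of \<open>Q\<close>; for \<open>Q = 0\<close> both sides are 0 since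
  \<open>sg e 0 x = 0\<close>.\<close>

lemma ind_coprime:
  assumes "poly P x \<noteq> 0 \<or> poly Q x \<noteq> 0"
  shows "ind e P Q x = (if poly Q x = 0 then sg e (P * Q) x / 2 else 0)"
proof (cases "P = 0 \<or> Q = 0")
  case True
  then show ?thesis by (auto simp: ind_def)
next
  case False
  show ?thesis
  proof (cases "poly Q x = 0")
    case True
    then have "Polynomial.order x P = 0" "Polynomial.order x Q > 0"
      using assms False by (auto simp: order_0I order_gt_0_iff)
    then show ?thesis using True False by (simp add: ind_def val_r_def)
  next
    case False
    then show ?thesis by (simp add: ind_def val_r_def order_0I)
  qed
qed

lemma ind_eq_0: "Q = 0 \<or> poly Q x \<noteq> 0 \<Longrightarrow> ind e P Q x = 0"
  by (auto simp: ind_def val_r_def order_0I)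

text \<open>Local product formula for \<open>P + i Q\<close> times \<open>R + i S\<close>, whose
  imaginary part is \<open>T\<close>. The right-hand side compares the sign of
  \<open>Q * S * T\<close> at \<open>x\<close> with its one-sided sign, so it is 0 unless one of the
  three vanishes there.\<close>

lemma ind_product_coprime:
  assumes e: "e = 1 \<or> e = - 1"
    and PQ: "poly P x \<noteq> 0 \<or> poly Q x \<noteq> 0" and RS: "poly R x \<noteq> 0 \<or> poly S x \<noteq> 0"
  defines "T \<equiv> P * S + Q * R"
  shows "ind e (P * R - Q * S) T x - ind e P Q x - ind e R S x
    = (sgn (poly Q x * poly S x * poly T x) - sg e (Q * S * T) x) / 2"
proof -
  define p q r s where "p = poly P x" and "q = poly Q x" and "r = poly R x" and "s = poly S x"
  note pqrs = p_def[symmetric] q_def[symmetric] r_def[symmetric] s_def[symmetric]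
  have T: "poly T x = p * s + q * r"
    by (simp add: T_def p_def q_def r_def s_def)
  have U: "poly (P * R - Q * S) x = p * r - q * s"
    by (simp add: p_def q_def r_def s_def)
  have pq: "p \<noteq> 0 \<or> q \<noteq> 0" and rs: "r \<noteq> 0 \<or> s \<noteq> 0"
    using PQ RS by (simp_all add: pqrs)
  \<comment> \<open>Multiplicativity of the norm: real and imaginary part of the product again do
    not both vanish at \<open>x\<close>.\<close>
  have "(p * p + q * q) * (r * r + s * s)
      = (p * r - q * s) * (p * r - q * s) + (p * s + q * r) * (p * s + q * r)"
    by (simp add: algebra_simps)
  then have "p * r - q * s \<noteq> 0 \<or> p * s + q * r \<noteq> 0"
    using sumsq_ne0[OF pq] sumsq_ne0[OF rs] by (metis add_0 mult_eq_0_iff)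
  then have UT: "poly (P * R - Q * S) x \<noteq> 0 \<or> poly T x \<noteq> 0"
    unfolding U T .
  note inds = ind_coprime[OF UT, of e] ind_coprime[OF PQ, of e] ind_coprime[OF RS, of e]
  have sgs: "y \<noteq> 0 \<Longrightarrow> sgn y * sgn y = 1" for y :: 'a
    by (auto simp: sgn_if)
  have sgs': "y \<noteq> 0 \<Longrightarrow> sgn y * (sgn y * z) = z" for y z :: 'a
    by (auto simp: sgn_if)
  show ?thesis
  proof (cases "q = 0"; cases "s = 0")
    assume "q \<noteq> 0" "s \<noteq> 0"
    show ?thesis
    proof (cases "p * s + q * r = 0")
      case False
      then have "sg e (Q * S * T) x = sgn (q * s * (p * s + q * r))"
        using \<open>q \<noteq> 0\<close> \<open>s \<noteq> 0\<close> by (subst sg_eq_sgn) (simp_all add: T pqrs)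
      then show ?thesis
        using False \<open>q \<noteq> 0\<close> \<open>s \<noteq> 0\<close> unfolding inds T pqrs by simp
    next
      case True
      then have "p * s = - (q * r)" by (simp add: eq_neg_iff_add_eq_0)
      \<comment> \<open>Where \<open>T\<close> vanishes, the real part of the product has the sign
        opposite to \<open>q * s\<close>; this fixes the index of the product.\<close>
      have "(p * r - q * s) * (q * s) = (p * s) * (r * q) - (q * s) * (q * s)"
        by (simp add: algebra_simps)
      also have "\<dots> = - ((q * r) * (q * r) + (q * s) * (q * s))"
        unfolding \<open>p * s = - (q * r)\<close> by (simp add: algebra_simps)
      finally have "(p * r - q * s) * (q * s) < 0"
        using \<open>q \<noteq> 0\<close> \<open>s \<noteq> 0\<close>
        by (metis add_nonneg_pos mult_eq_0_iff neg_less_0_iff_less not_square_less_zero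
            not_less zero_le_square linorder_neqE_linordered_idom)
      then have "sgn (p * r - q * s) = - (sgn q * sgn s)" and U0: "p * r - q * s \<noteq> 0"
        by (auto simp: sgn_if mult_less_0_iff zero_less_mult_iff split: if_splits)
      moreover have "sg e Q x = sgn q" "sg e S x = sgn s"
        using \<open>q \<noteq> 0\<close> \<open>s \<noteq> 0\<close> by (simp_all add: sg_eq_sgn q_def s_def)
      moreover have "sg e (P * R - Q * S) x = sgn (p * r - q * s)"
        using U0 U sg_eq_sgn by metis
      ultimately show ?thesis
        using True \<open>q \<noteq> 0\<close> \<open>s \<noteq> 0\<close> unfolding inds T pqrs by (simp add: sg_mult)
    qed
  next
    assume "q = 0" "s \<noteq> 0"
    then have "p \<noteq> 0" using pq by simp
    have "sg e T x = sgn p * sgn s" "sg e P x = sgn p" "sg e S x = sgn s"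
      using \<open>p \<noteq> 0\<close> \<open>s \<noteq> 0\<close> \<open>q = 0\<close> by (simp_all add: sg_eq_sgn T p_def[symmetric] s_def[symmetric] sgn_mult)
    then show ?thesis
      using \<open>q = 0\<close> \<open>s \<noteq> 0\<close> \<open>p \<noteq> 0\<close> unfolding inds T pqrs
      by (simp add: sg_mult mult_ac sgs sgs')
  next
    assume "q \<noteq> 0" "s = 0"
    then have "r \<noteq> 0" using rs by simp
    have "sg e T x = sgn q * sgn r" "sg e R x = sgn r" "sg e Q x = sgn q"
      using \<open>r \<noteq> 0\<close> \<open>q \<noteq> 0\<close> \<open>s = 0\<close> by (simp_all add: sg_eq_sgn T r_def[symmetric] q_def[symmetric] sgn_mult)
    then show ?thesis
      using \<open>s = 0\<close> \<open>q \<noteq> 0\<close> \<open>r \<noteq> 0\<close> unfolding inds T pqrs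
      by (simp add: sg_mult mult_ac sgs sgs')
  next
    assume "q = 0" "s = 0"
    then have "p \<noteq> 0" "r \<noteq> 0" using pq rs by auto
    have sP: "sg e P x = sgn p" and sR: "sg e R x = sgn r"
      using \<open>p \<noteq> 0\<close> \<open>r \<noteq> 0\<close> by (simp_all add: sg_eq_sgn p_def r_def)
    have sU: "sg e (P * R - Q * S) x = sgn p * sgn r"
      using \<open>p \<noteq> 0\<close> \<open>r \<noteq> 0\<close> \<open>q = 0\<close> U by (subst sg_eq_sgn) (simp_all add: pqrs sgn_mult)
    define \<alpha> \<beta> \<omega> where "\<alpha> = sg e (P * Q) x" and "\<beta> = sg e (R * S) x"
      and "\<omega> = sg e (P * R * T) x"
    \<comment> \<open>\<open>T / (P R)\<close> is \<open>Q / P + S / R\<close>, so a common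
      one-sided sign of the summands passes to the sum. For opposite signs the identity below holds
      whatever \<open>\<omega>\<close> is.\<close>
    have \<omega>: "\<omega> = \<alpha>" if "\<alpha> = \<beta>"
    proof -
      have "P * R * T = (R * R) * (P * Q) + (P * P) * (R * S)"
        by (simp add: T_def algebra_simps)
      moreover have "sg e ((R * R) * (P * Q)) x = \<alpha>" "sg e ((P * P) * (R * S)) x = \<beta>"
        using \<open>p \<noteq> 0\<close> \<open>r \<noteq> 0\<close> by (simp_all add: \<alpha>_def \<beta>_def sg_mult sP sR sgs sgs' mult.assoc)
      ultimately show ?thesis using sg_add[OF e] that \<omega>_def by metis
    qed
    have \<omega>Q: "\<omega> = \<beta>" if "Q = 0"
      using that \<open>p \<noteq> 0\<close> by (simp add: \<omega>_def \<beta>_def T_def sg_mult sP sgs' mult_ac)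
    have \<omega>S: "\<omega> = \<alpha>" if "S = 0"
      using that \<open>r \<noteq> 0\<close> by (simp add: \<omega>_def \<alpha>_def T_def sg_mult sR sgs' mult_ac)
    have vals: "\<alpha> = 1 \<or> \<alpha> = -1 \<or> Q = 0" "\<beta> = 1 \<or> \<beta> = -1 \<or> S = 0"
      using sg_cases[OF e, of "P * Q" x] sg_cases[OF e, of "R * S" x] \<open>p \<noteq> 0\<close> \<open>r \<noteq> 0\<close>
      by (auto simp: \<alpha>_def \<beta>_def p_def r_def)
    have \<alpha>0: "Q = 0 \<Longrightarrow> \<alpha> = 0" and \<beta>0: "S = 0 \<Longrightarrow> \<beta> = 0"
      by (simp_all add: \<alpha>_def \<beta>_def)
    have "\<omega> - \<alpha> - \<beta> = - (\<alpha> * \<beta> * \<omega>)"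
      using vals \<omega> \<omega>Q \<omega>S \<alpha>0 \<beta>0 by (elim disjE) auto
    moreover have "sg e (Q * S * T) x = \<alpha> * \<beta> * \<omega>"
      using \<open>p \<noteq> 0\<close> \<open>r \<noteq> 0\<close> by (simp add: \<alpha>_def \<beta>_def \<omega>_def sg_mult sP sR sgs sgs' mult_ac)
    moreover have "sg e ((P * R - Q * S) * T) x = \<omega>"
      by (simp add: \<omega>_def sg_mult sU sP sR)
    ultimately show ?thesis
      using \<open>q = 0\<close> \<open>s = 0\<close> unfolding inds T pqrs \<alpha>_def[symmetric] \<beta>_def[symmetric]
      by (simp add: field_simps)
  qed
qed

section \<open>The product formula on an edge\<close>

lemma re_sum: "re (sum f A) = (\<Sum>i\<in>A. re (f i))" and im_sum: "im (sum f A) = (\<Sum>i\<in>A. im (f i))"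
  by (induction A rule: infinite_finite_induct) auto

lemma map_poly_re_mult:
  "map_poly re (h * k) = map_poly re h * map_poly re k - map_poly im h * map_poly im k"
  by (rule poly_eqI) (simp add: coeff_map_poly coeff_mult re_sum sum_subtractf)

lemma map_poly_im_mult:
  "map_poly im (h * k) = map_poly re h * map_poly im k + map_poly im h * map_poly re k"
  by (rule poly_eqI) (simp add: coeff_map_poly coeff_mult im_sum sum.distrib)

lemma poly_map_poly_re: "poly (map_poly re h) x = re (poly h (of_re x))"
  by (induction h) (simp_all add: map_poly_pCons)

lemma poly_map_poly_im: "poly (map_poly im h) x = im (poly h (of_re x))"
  by (induction h) (simp_all add: map_poly_pCons)

lemma map_poly_of_re_scale:
  "map_poly re (map_poly of_re r * h) = r * map_poly re h"
  "map_poly im (map_poly of_re r * h) = r * map_poly im h"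
proof -
  have "map_poly re (map_poly of_re r) = r" "map_poly im (map_poly of_re r) = 0"
    by (rule poly_eqI; simp add: coeff_map_poly)+
  then show "map_poly re (map_poly of_re r * h) = r * map_poly re h"
    "map_poly im (map_poly of_re r * h) = r * map_poly im h"
    by (simp_all add: map_poly_re_mult map_poly_im_mult)
qed

lemma map_poly_of_re_add: "map_poly of_re (p + q) = map_poly of_re p + map_poly of_re q"
  by (rule poly_eqI) (simp add: coeff_map_poly)

lemma map_poly_of_re_mult: "map_poly of_re (p * q) = map_poly of_re p * map_poly of_re q"
  by (rule map_poly_hom_mult) simp_all

lemma map_poly_of_re_linear_power:
  "map_poly of_re ([:- x, 1:] ^ n) = [:- of_re x, 1:] ^ n"
  by (induction n) (simp_all add: map_poly_of_re_mult map_poly_pCons del: mult_pCons_left)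

(* (arg z + arg w - arg (z * w)) / pi equals (1 - corr z w) / 2 for arguments taken modulo pi in (0, pi),
   where real numbers get pi / 2. *)
definition corr :: "'a::linordered_field cplx \<Rightarrow> 'a cplx \<Rightarrow> 'a" where
  "corr z w = sgn (im z * im w * im (z * w))"

text \<open>The powers of \<open>X - x\<close> in \<open>h\<close> and \<open>k\<close> are real, so
  they scale real and imaginary parts alike and enter the signs squared. The cofactors left over
  satisfy the hypotheses of \<open>ind_product_coprime\<close>.\<close>

lemma ind_product:
  fixes h k :: "'a::linordered_field cplx poly"
  assumes e: "e = 1 \<or> e = - 1" and "h \<noteq> 0" and "k \<noteq> 0"
  shows "ind e (map_poly re (h * k)) (map_poly im (h * k)) x
      - ind e (map_poly re h) (map_poly im h) x - ind e (map_poly re k) (map_poly im k) x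
    = (corr (poly (cofactor h (of_re x)) (of_re x)) (poly (cofactor k (of_re x)) (of_re x))
      - sg e (map_poly im h * map_poly im k * map_poly im (h * k)) x) / 2"
proof -
  define u v where "u = cofactor h (of_re x)" and "v = cofactor k (of_re x)"
  define r s where "r = [:- x, 1:] ^ Polynomial.order (of_re x) h"
    and "s = [:- x, 1:] ^ Polynomial.order (of_re x) k"
  define P Q R S where "P = map_poly re u" and "Q = map_poly im u"
    and "R = map_poly re v" and "S = map_poly im v"
  define T where "T = P * S + Q * R"
  have h: "h = map_poly of_re r * u" and k: "k = map_poly of_re s * v"
    unfolding r_def s_def map_poly_of_re_linear_power u_def v_def
    by (intro cofactor_decomp(1) assms)+
  have reh: "map_poly re h = r * P" and imh: "map_poly im h = r * Q"
    and rek: "map_poly re k = s * R" and imk: "map_poly im k = s * S"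
    unfolding h k P_def Q_def R_def S_def by (rule map_poly_of_re_scale)+
  have rehk: "map_poly re (h * k) = (r * s) * (P * R - Q * S)"
    unfolding map_poly_re_mult reh imh rek imk by (simp only: algebra_simps)
  have imhk: "map_poly im (h * k) = (r * s) * T"
    unfolding map_poly_im_mult reh imh rek imk T_def by (simp only: algebra_simps)
  have "r \<noteq> 0" "s \<noteq> 0" by (simp_all add: r_def s_def)
  have u0: "poly u (of_re x) \<noteq> 0" and v0: "poly v (of_re x) \<noteq> 0"
    unfolding u_def v_def by (intro cofactor_decomp(2) assms)+
  have "poly P x \<noteq> 0 \<or> poly Q x \<noteq> 0" "poly R x \<noteq> 0 \<or> poly S x \<noteq> 0"
    using u0 v0 by (auto simp: P_def Q_def R_def S_def poly_map_poly_re poly_map_poly_im cplx_eq_iff)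
  note main = ind_product_coprime[OF e this, folded T_def]
  have "corr (poly u (of_re x)) (poly v (of_re x)) = sgn (poly Q x * poly S x * poly T x)"
    by (simp add: corr_def T_def P_def Q_def R_def S_def poly_map_poly_re poly_map_poly_im)
  moreover have "sg e (map_poly im h * map_poly im k * map_poly im (h * k)) x = sg e (Q * S * T) x"
    unfolding imh imk imhk using sg_cases[OF e, of r x] sg_cases[OF e, of s x] \<open>r \<noteq> 0\<close> \<open>s \<noteq> 0\<close>
    by (auto simp: sg_mult)
  ultimately show ?thesis
    using main \<open>r \<noteq> 0\<close> \<open>s \<noteq> 0\<close>
    unfolding rehk unfolding imhk reh imh rek imk
    by (simp add: ind_scale[OF _ e] u_def[symmetric] v_def[symmetric] imhk imh imk)
qed

section \<open>The intermediate value property\<close>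

lemma complex_root_quadratic_dvd:
  fixes P :: "'a::real_closed_field poly"
  assumes z: "poly (map_poly of_re P) z = 0" and "im z \<noteq> 0"
  shows "[:re z * re z + im z * im z, - 2 * re z, 1:] dvd P"
proof -
  define D where "D = [:re z * re z + im z * im z, - 2 * re z, 1:]"
  define r where "r = P mod D"
  have "poly (map_poly of_re D) z = 0"
    by (simp add: D_def map_poly_pCons cplx_eq_iff algebra_simps)
  moreover have "P = D * (P div D) + r"
    by (simp add: r_def)
  then have "map_poly of_re P = map_poly of_re D * map_poly of_re (P div D) + map_poly of_re r"
    by (metis map_poly_of_re_add map_poly_of_re_mult)
  ultimately have rz: "poly (map_poly of_re r) z = 0"
    using z by simp
  have "degree D = 2" by (simp add: D_def)
  then have "degree r < 2"
    using degree_mod_less'[of D P] by (cases "r = 0") (auto simp: r_def D_def)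
  define c d where "c = poly.coeff r 0" and "d = poly.coeff r 1"
  have r: "r = [:c, d:]"
  proof (rule poly_eqI)
    fix n
    show "poly.coeff r n = poly.coeff [:c, d:] n"
      using \<open>degree r < 2\<close>
      by (cases n; cases "n - 1") (auto simp: c_def d_def coeff_pCons coeff_eq_0 split: nat.split)
  qed
  \<comment> \<open>Real and imaginary part of \<open>c + d z = 0\<close>; as \<open>im z\<close> is
    nonzero, first \<open>d\<close> and then \<open>c\<close> vanishes.\<close>
  have "c + re z * d = 0" "im z * d = 0"
    using rz by (auto simp: r map_poly_pCons cplx_eq_iff split: if_splits)
  then have "r = 0" using assms(2) r by auto
  then show ?thesis by (simp add: D_def r_def mod_eq_0_iff_dvd)
qed

lemma sg_linear:
  fixes x t :: "'a::linordered_field"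
  shows "sg e [:- x, 1:] t = (if t = x then e else sgn (t - x))"
  using sg_eqI[of "[:- x, 1:]" x 1 1 e] by (auto simp: sg_eq_sgn)

(* The intermediate value property, as constancy of the sign of P on a root-free interval. *)
lemma sg_no_roots:
  fixes P :: "'a::real_closed_field poly"
  assumes "a < b" and "P \<noteq> 0" and "\<And>x. a < x \<Longrightarrow> x < b \<Longrightarrow> poly P x \<noteq> 0"
  shows "sg 1 P a = sg (- 1) P b"
  using assms(2,3)
proof (induction "degree P" arbitrary: P rule: less_induct)
  case less
  show ?case
  proof (cases "degree P = 0")
    case True
    then obtain c where "P = [:c:]" by (rule degree_eq_zeroE)
    then show ?thesis using less.prems by (simp add: sg_eq_sgn)
  next
    case False
    have "degree (map_poly of_re P) = degree P"
      by (simp add: degree_map_poly cplx_eq_iff)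
    then obtain z where z: "poly (map_poly of_re P) z = 0"
      using alg_closed_imp_poly_has_root[of "map_poly of_re P"] False by auto
    \<comment> \<open>A factor of constant sign on the interval is split off: \<open>X - x\<close>
      for a real root outside, else the positive quadratic of a conjugate pair.\<close>
    have "\<exists>D. D dvd P \<and> degree D > 0 \<and> sg 1 D a = sg (- 1) D b"
    proof (cases "im z = 0")
      case True
      define x where "x = re z"
      have "z = of_re x" using True by (simp add: cplx_eq_iff x_def)
      then have "of_re (poly P x) = 0"
        using z poly_map_poly_hom[of of_re P x] by simp
      then have "poly P x = 0" by (simp add: cplx_eq_iff)
      then have "x \<le> a \<or> b \<le> x" using less.prems(2) not_le by blast
      \<comment> \<open>This includes a root at an endpoint, because both one-sided signs look into
        the interval.\<close>
      then have "sg 1 [:- x, 1:] a = sg (- 1) [:- x, 1:] b"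
        using assms(1) by (auto simp: sg_linear sgn_if)
      then show ?thesis
        using \<open>poly P x = 0\<close> by (intro exI[of _ "[:- x, 1:]"]) (simp add: poly_eq_0_iff_dvd)
    next
      case False
      define D where "D = [:re z * re z + im z * im z, - 2 * re z, 1:]"
      have "poly D t > 0" for t
      proof -
        have "poly D t = (t - re z) * (t - re z) + im z * im z"
          by (simp add: D_def algebra_simps)
        then show ?thesis
          using False by (metis add_nonneg_pos not_square_less_zero zero_le_square mult_eq_0_iff
              linorder_neqE_linordered_idom)
      qed
      then have "sg e D t = 1" for e t
        by (metis sg_eq_sgn sgn_pos less_irrefl)
      then show ?thesis
        using complex_root_quadratic_dvd[OF z False] by (intro exI[of _ D]) (simp add: D_def)
    qed
    then obtain D P' where P: "P = D * P'" and "degree D > 0" and D: "sg 1 D a = sg (- 1) D b"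
      by (auto elim!: dvdE)
    have "D \<noteq> 0" "P' \<noteq> 0" using P less.prems by auto
    then have "degree P' < degree P"
      using \<open>degree D > 0\<close> by (simp add: P degree_mult_eq)
    then have "sg 1 P' a = sg (- 1) P' b"
      using \<open>P' \<noteq> 0\<close> less.prems(2) by (intro less.hyps) (auto simp: P)
    then show ?thesis by (simp add: P sg_mult D)
  qed
qed

text \<open>A telescoping sum: \<open>sg_no_roots\<close> equates the right sign at a point of
  \<open>A\<close> with the left sign at the next one. The induction removes the largest point
  \<open>c\<close> and applies the claim with \<open>c\<close> for \<open>b\<close>.\<close>

lemma sum_sg_jumps:
  fixes P :: "'a::real_closed_field poly"
  assumes "finite A" and "A \<subseteq> {a<..<b}" and "a < b"
    and "P \<noteq> 0 \<Longrightarrow> {x. a < x \<and> x < b \<and> poly P x = 0} \<subseteq> A"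
  shows "(\<Sum>x\<in>A. sg 1 P x - sg (- 1) P x) = sg (- 1) P b - sg 1 P a"
proof (cases "P = 0")
  case False
  show ?thesis
    using assms(1) assms(2,3) assms(4)[OF False]
  proof (induction A arbitrary: b rule: finite_linorder_max_induct)
    case empty
    then show ?case using sg_no_roots[OF empty.prems(2) False] by auto
  next
    case (insert c A)
    have "a < c" "c < b" using insert.prems by auto
    have "poly P x \<noteq> 0" if "c < x" "x < b" for x
    proof
      assume "poly P x = 0"
      then have "x \<in> insert c A"
        using that insert.prems(3) less_trans[OF \<open>a < c\<close> that(1)] by auto
      then show False using that insert.hyps(2) by force
    qed
    then have "sg 1 P c = sg (- 1) P b"
      using sg_no_roots \<open>c < b\<close> False by blast
    moreover have "(\<Sum>x\<in>A. sg 1 P x - sg (- 1) P x) = sg (- 1) P c - sg 1 P a"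
    proof (rule insert.IH)
      show "A \<subseteq> {a<..<c}" using insert.prems insert.hyps by auto
      show "{x. a < x \<and> x < c \<and> poly P x = 0} \<subseteq> A"
      proof
        fix x assume "x \<in> {x. a < x \<and> x < c \<and> poly P x = 0}"
        then have "x \<noteq> c" "x \<in> {x. a < x \<and> x < b \<and> poly P x = 0}"
          using less_trans[OF _ \<open>c < b\<close>, of x] by auto
        then show "x \<in> A" using insert.prems(3) by blast
      qed
    qed fact
    moreover have "c \<notin> A" using insert.hyps by auto
    ultimately show ?case using insert.hyps(1) by simp
  qed
qed simp

text \<open>Letting any finite set that contains the interior zeros of \<open>Q\<close> index the
  sum allows several edge indices to share one set.\<close>

lemma ind_between_eq:
  assumes "a < b" and "finite A" and "A \<subseteq> {a<..<b}"
    and "Q \<noteq> 0 \<Longrightarrow> {x. a < x \<and> x < b \<and> poly Q x = 0} \<subseteq> A"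
  shows "ind_between a b P Q
    = ind 1 P Q a + (\<Sum>x\<in>A. ind 1 P Q x - ind (- 1) P Q x) - ind (- 1) P Q b"
proof -
  have at: "ind_at P Q x = ind 1 P Q x - ind (- 1) P Q x" for x
    by (simp add: ind_at_def ind_plus_eq ind_minus_eq)
  have "x \<in> A" if "a < x" "x < b" "ind_at P Q x \<noteq> 0" for x
  proof -
    have "\<not> (Q = 0 \<or> poly Q x \<noteq> 0)"
      using that(3) ind_eq_0[of Q x] by (metis at diff_self)
    then show ?thesis using that assms(4) by auto
  qed
  then have "(\<Sum>x\<in>{x. a < x \<and> x < b \<and> ind_at P Q x \<noteq> 0}. ind_at P Q x) = (\<Sum>x\<in>A. ind_at P Q x)"
    using assms(3) by (intro sum.mono_neutral_left assms(2)) auto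
  then show ?thesis
    using assms(1) by (simp add: ind_between_def ind_plus_eq ind_minus_eq at)
qed

text \<open>\<open>ind_product\<close> is summed over a common set \<open>A\<close>. At each
  interior point the \<open>corr\<close> terms of the two sides cancel, and the jumps of
  \<open>sg e W\<close> telescope against the one-sided signs at \<open>a\<close> and
  \<open>b\<close>, leaving \<open>corr\<close> at the endpoints.\<close>

lemma ind_edge_mult:
  fixes h k :: "'a::real_closed_field cplx poly"
  assumes ab: "a < b"
    and ha: "poly h (of_re a) \<noteq> 0" and hb: "poly h (of_re b) \<noteq> 0"
    and ka: "poly k (of_re a) \<noteq> 0" and kb: "poly k (of_re b) \<noteq> 0"
  shows "ind_edge a b (h * k) = ind_edge a b h + ind_edge a b k
    + (corr (poly h (of_re a)) (poly k (of_re a)) - corr (poly h (of_re b)) (poly k (of_re b))) / 2"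
proof -
  have nz: "h \<noteq> 0" "k \<noteq> 0" using ha ka by auto
  define Q R T W where "Q = map_poly im h" and "R = map_poly im k" and "T = map_poly im (h * k)"
    and "W = Q * R * T"
  \<comment> \<open>The zero polynomial gets the empty set, so that \<open>A\<close> stays finite
    when an imaginary part vanishes identically.\<close>
  define Z where "Z p = (if p = 0 then {} else {x. poly p x = 0})" for p :: "'a poly"
  define A where "A = {a<..<b} \<inter> (Z Q \<union> Z R \<union> Z T \<union> Z W)"
  have "finite (Z p)" for p
    by (simp add: Z_def poly_roots_finite)
  then have A: "finite A" "A \<subseteq> {a<..<b}"
    by (auto simp: A_def)
  have AZ: "{x. a < x \<and> x < b \<and> poly p x = 0} \<subseteq> A"
    if "p \<noteq> 0" "p = Q \<or> p = R \<or> p = T \<or> p = W" for p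
    using that by (auto simp: A_def Z_def)
  define i where "i e p x = ind e (map_poly re p) (map_poly im p) x" for e and p :: "'a cplx poly" and x
  define \<delta> where "\<delta> x = corr (poly (cofactor h (of_re x)) (of_re x)) (poly (cofactor k (of_re x)) (of_re x))" for x
  have loc: "i e (h * k) x = i e h x + i e k x + (\<delta> x - sg e W x) / 2" if "e = 1 \<or> e = - 1" for e x
  proof -
    have "i e (h * k) x - i e h x - i e k x = (\<delta> x - sg e W x) / 2"
      using ind_product[OF that nz, of x] by (simp only: i_def \<delta>_def W_def Q_def R_def T_def)
    then show ?thesis by linarith
  qed
  note loc1 = loc[of 1, simplified] and loc2 = loc[of "- 1", simplified]
  have edge: "ind_edge a b p = i 1 p a + (\<Sum>x\<in>A. i 1 p x - i (- 1) p x) - i (- 1) p b"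
    if "p = h \<or> p = k \<or> p = h * k" for p
    unfolding ind_edge_def i_def
    by (rule ind_between_eq[OF ab A]) (use that AZ in \<open>auto simp: Q_def R_def T_def\<close>)
  have "(\<Sum>x\<in>A. i 1 (h * k) x - i (- 1) (h * k) x)
      = (\<Sum>x\<in>A. (i 1 h x - i (- 1) h x) + (i 1 k x - i (- 1) k x) - (sg 1 W x - sg (- 1) W x) / 2)"
    by (intro sum.cong refl) (simp add: loc1 loc2 field_simps)
  also have "\<dots> = (\<Sum>x\<in>A. i 1 h x - i (- 1) h x) + (\<Sum>x\<in>A. i 1 k x - i (- 1) k x)
      - (\<Sum>x\<in>A. sg 1 W x - sg (- 1) W x) / 2"
    by (simp only: sum.distrib sum_subtractf flip: sum_divide_distrib)
  also have "(\<Sum>x\<in>A. sg 1 W x - sg (- 1) W x) = sg (- 1) W b - sg 1 W a"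
    using AZ by (intro sum_sg_jumps A ab) blast
  finally have "ind_edge a b (h * k) = ind_edge a b h + ind_edge a b k + (\<delta> a - \<delta> b) / 2"
    by (simp add: edge loc1 loc2 field_simps)
  \<comment> \<open>At the endpoints nothing is divided out, so \<open>\<delta>\<close> there is
    \<open>corr\<close> of the actual values.\<close>
  moreover have "cofactor p z = p" if "poly p z \<noteq> 0" for p :: "'a cplx poly" and z
    using that by (intro cofactor_eqI(2)[of _ _ 0]) simp_all
  then have "\<delta> a = corr (poly h (of_re a)) (poly k (of_re a))"
    "\<delta> b = corr (poly h (of_re b)) (poly k (of_re b))"
    using ha hb ka kb by (simp_all add: \<delta>_def)
  ultimately show ?thesis by simp
qed

section \<open>Winding numbers around a rectangle\<close>

lemma ind_edge_swap: "a < b \<Longrightarrow> ind_edge b a h = - ind_edge a b h"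
  by (simp add: ind_edge_def ind_between_def)

lemma ind_edge_scale:
  assumes "r \<noteq> 0"
  shows "ind_edge a b (map_poly of_re r * h) = ind_edge a b h"
  using assms by (simp add: ind_edge_def ind_between_def ind_at_def ind_plus_eq ind_minus_eq
      map_poly_of_re_scale ind_scale)

lemma ind_edge_cnj: "ind_edge a b (map_poly cnj h) = - ind_edge a b h"
proof -
  have "map_poly re (map_poly cnj h) = map_poly re h" "map_poly im (map_poly cnj h) = - map_poly im h"
    by (rule poly_eqI; simp add: coeff_map_poly)+
  moreover have "ind_between a b P (- Q) = - ind_between a b P Q" for P Q :: "'a poly"
  proof -
    have at: "ind_at P (- Q) x = - ind_at P Q x" for x
      by (simp add: ind_at_def ind_plus_eq ind_minus_eq ind_uminus)
    show ?thesis
      by (simp add: ind_between_def at ind_plus_eq ind_minus_eq ind_uminus sum_negf)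
  qed
  ultimately show ?thesis by (simp add: ind_edge_def)
qed

lemma ind_between_no_poles:
  assumes "\<And>e x. ind e P Q x = 0"
  shows "ind_between a b P Q = 0"
  by (simp add: ind_between_def ind_at_def ind_plus_eq ind_minus_eq assms)

lemma hline_q_mult: "hline_q (F * F') (G * G') y = hline_q F G y * hline_q F' G' y"
  by (simp add: hline_q_def hline_def pcompose_mult map_poly_cnj_mult mult_ac)

lemma vline_q_mult: "vline_q (F * F') (G * G') x = vline_q F G x * vline_q F' G' x"
  by (simp add: vline_q_def vline_def pcompose_mult map_poly_cnj_mult mult_ac)

lemma poly_hline_q:
  "poly (hline_q F G y) (of_re t) = poly F (Cplx t y) * cnj (poly G (Cplx t y))"
proof -
  have "poly [:Cplx 0 y, 1:] (of_re t) = Cplx t y"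
    by (simp add: cplx_eq_iff)
  then have "poly (hline H y) (of_re t) = poly H (Cplx t y)" for H
    by (simp add: hline_def poly_pcompose)
  then show ?thesis
    using poly_map_poly_cnj[of "hline G y" "of_re t"] by (simp add: hline_q_def)
qed

lemma poly_vline_q:
  "poly (vline_q F G x) (of_re t) = poly F (Cplx x t) * cnj (poly G (Cplx x t))"
proof -
  have "poly [:Cplx x 0, Cplx 0 1:] (of_re t) = Cplx x t"
    by (simp add: cplx_eq_iff)
  then have "poly (vline H x) (of_re t) = poly H (Cplx x t)" for H
    by (simp add: vline_def poly_pcompose)
  then show ?thesis
    using poly_map_poly_cnj[of "vline G x" "of_re t"] by (simp add: vline_q_def)
qed

lemma hline_nonzero: "F \<noteq> 0 \<Longrightarrow> hline F y \<noteq> 0" and vline_nonzero: "F \<noteq> 0 \<Longrightarrow> vline F x \<noteq> 0"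
  by (simp_all add: hline_def vline_def pcompose_eq_0_iff cplx_eq_iff)

text \<open>On a line, \<open>H\<close> times its conjugate restricts to a nonzero real polynomial,
  and scaling by it leaves every edge index unchanged.\<close>

lemma wind_rect_cancel:
  assumes "H \<noteq> 0"
  shows "wind_rect (H * F) (H * G) x0 x1 y0 y1 = wind_rect F G x0 x1 y0 y1"
proof -
  have scale: "ind_edge a b (p * map_poly cnj p * h) = ind_edge a b h" if "p \<noteq> 0" for a b p and h :: "'a cplx poly"
  proof -
    obtain r where r: "p * map_poly cnj p = map_poly of_re r"
      using mult_cnj_real by blast
    have "p * map_poly cnj p \<noteq> 0"
      using that by (simp add: map_poly_eq_0_iff)
    then have "r \<noteq> 0" using r by auto
    then show ?thesis unfolding r by (rule ind_edge_scale)
  qed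
  have "ind_edge a b (hline_q (H * F) (H * G) y) = ind_edge a b (hline_q F G y)" for a b y
    unfolding hline_q_mult using scale[OF hline_nonzero[OF assms]] by (simp add: hline_q_def)
  moreover have "ind_edge a b (vline_q (H * F) (H * G) x) = ind_edge a b (vline_q F G x)" for a b x
    unfolding vline_q_mult using scale[OF vline_nonzero[OF assms]] by (simp add: vline_q_def)
  ultimately show ?thesis by (simp add: wind_rect_def)
qed

text \<open>The restrictions for \<open>1 / G\<close> are the conjugates of those for
  \<open>G\<close>, and conjugation negates every edge index.\<close>

lemma wind_rect_inverse: "wind_rect 1 G x0 x1 y0 y1 = - wind_rect G 1 x0 x1 y0 y1"
proof -
  have h: "hline_q 1 G y = map_poly cnj (hline_q G 1 y)" and v: "vline_q 1 G x = map_poly cnj (vline_q G 1 x)" for x y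
    by (simp_all add: hline_q_def vline_q_def hline_def vline_def pcompose_1)
  show ?thesis
    unfolding wind_rect_def h v ind_edge_cnj by (simp add: field_simps)
qed

lemma wind_rect_const: "wind_rect [:c:] 1 x0 x1 y0 y1 = 0"
proof -
  have "ind e [:a:] [:b:] t = 0" for e a b t :: 'a
    by (rule ind_eq_0) simp
  then have "ind_edge a b [:c:] = 0" for a b
    by (simp add: ind_edge_def map_poly_pCons ind_between_no_poles)
  then show ?thesis
    by (simp add: wind_rect_def hline_q_def vline_q_def hline_def vline_def pcompose_1)
qed

section \<open>Counting zeros in a fixed rectangle\<close>

locale rectangle =
  fixes x0 x1 y0 y1 :: "'a::real_closed_field"
  assumes x_less: "x0 < x1" and y_less: "y0 < y1"
begin

abbreviation "w F G \<equiv> wind_rect F G x0 x1 y0 y1"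

definition corners :: "'a cplx set" where
  "corners = {Cplx x0 y0, Cplx x1 y0, Cplx x1 y1, Cplx x0 y1}"

text \<open>The weighted count for a single polynomial; the sum in the theorem is
  \<open>zeros F - zeros G\<close>.\<close>

definition zeros :: "'a cplx poly \<Rightarrow> 'a" where
  "zeros F = (\<Sum>z\<in>{z. in_rect x0 x1 y0 y1 z \<and> poly F z = 0}.
    c_rect x0 x1 y0 y1 z * of_nat (Polynomial.order z F))"

(* The boundary terms of ind_edge_mult at the corners cancel around the rectangle. *)
lemma wind_rect_mult:
  assumes "\<And>z. z \<in> corners \<Longrightarrow> poly F z \<noteq> 0 \<and> poly G z \<noteq> 0 \<and> poly F' z \<noteq> 0 \<and> poly G' z \<noteq> 0"
  shows "w (F * F') (G * G') = w F G + w F' G'"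
proof -
  define \<delta> where "\<delta> z = corr (poly F z * cnj (poly G z)) (poly F' z * cnj (poly G' z))" for z
  have h: "ind_edge x0 x1 (hline_q (F * F') (G * G') y) = ind_edge x0 x1 (hline_q F G y)
      + ind_edge x0 x1 (hline_q F' G' y) + (\<delta> (Cplx x0 y) - \<delta> (Cplx x1 y)) / 2"
    if "y = y0 \<or> y = y1" for y
    unfolding hline_q_mult \<delta>_def poly_hline_q[symmetric]
    by (rule ind_edge_mult[OF x_less])
      (use that assms in \<open>auto simp: poly_hline_q corners_def\<close>)
  have v: "ind_edge y0 y1 (vline_q (F * F') (G * G') x) = ind_edge y0 y1 (vline_q F G x)
      + ind_edge y0 y1 (vline_q F' G' x) + (\<delta> (Cplx x y0) - \<delta> (Cplx x y1)) / 2"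
    if "x = x0 \<or> x = x1" for x
    unfolding vline_q_mult \<delta>_def poly_vline_q[symmetric]
    by (rule ind_edge_mult[OF y_less])
      (use that assms in \<open>auto simp: poly_vline_q corners_def\<close>)
  show ?thesis
    by (simp add: wind_rect_def ind_edge_swap[OF x_less] ind_edge_swap[OF y_less] h v field_simps)
qed

lemma zeros_eq:
  assumes "F \<noteq> 0" and "finite A" and "\<And>z. z \<in> A \<Longrightarrow> in_rect x0 x1 y0 y1 z"
    and "\<And>z. in_rect x0 x1 y0 y1 z \<Longrightarrow> poly F z = 0 \<Longrightarrow> z \<in> A"
  shows "zeros F = (\<Sum>z\<in>A. c_rect x0 x1 y0 y1 z * of_nat (Polynomial.order z F))"
  unfolding zeros_def
  by (rule sum.mono_neutral_left) (use assms in \<open>auto simp: order_0I\<close>)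

lemma zeros_mult:
  assumes "F \<noteq> 0" and "H \<noteq> 0"
  shows "zeros (F * H) = zeros F + zeros H"
proof -
  define A where "A = {z. in_rect x0 x1 y0 y1 z \<and> (poly F z = 0 \<or> poly H z = 0)}"
  have "finite A"
    by (rule finite_subset[of _ "{z. poly F z = 0} \<union> {z. poly H z = 0}"])
      (use assms in \<open>auto simp: A_def poly_roots_finite\<close>)
  then have "zeros p = (\<Sum>z\<in>A. c_rect x0 x1 y0 y1 z * of_nat (Polynomial.order z p))"
    if "p \<in> {F, H, F * H}" for p
    using that assms by (intro zeros_eq) (auto simp: A_def)
  then show ?thesis
    using assms by (simp add: order_mult sum.distrib[symmetric] algebra_simps)
qed

lemma zeros_linear:
  "zeros [:- z, 1:] = (if in_rect x0 x1 y0 y1 z then c_rect x0 x1 y0 y1 z else 0)"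
proof -
  have "{u. in_rect x0 x1 y0 y1 u \<and> poly [:- z, 1:] u = 0} = (if in_rect x0 x1 y0 y1 z then {z} else {})"
    by auto
  moreover have "Polynomial.order z [:- z, 1:] = 1"
    using order_power_n_n[of z 1] by simp
  ultimately show ?thesis by (simp add: zeros_def)
qed

text \<open>On horizontal edges the imaginary part is constant, so the index is 0. On a vertical
  edge it is \<open>T - b\<close>, with one pole weighted by \<open>\<kappa>\<close>: 1 inside, 1/2
  at an endpoint. The real part contributes \<open>sgn (x - a)\<close>, and the two vertical edges
  combine to the count. A corner would give 1/4, hence the hypothesis.\<close>

lemma wind_rect_linear:
  assumes "z \<notin> corners"
  shows "w [:- z, 1:] 1 = zeros [:- z, 1:]"
proof -
  define a b where "a = re z" and "b = im z"
  define \<kappa> :: 'a where "\<kappa> = (if y0 < b \<and> b < y1 then 1 else if b = y0 \<or> b = y1 then 1 / 2 else 0)"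
  have h: "ind_edge x0 x1 (hline_q [:- z, 1:] 1 y) = 0" for y
  proof -
    have "hline_q [:- z, 1:] 1 y = [:Cplx 0 y - z, 1:]"
      by (simp add: hline_q_def hline_def pcompose_1 pcompose_pCons)
    moreover have "ind e P [:c:] t = 0" for e P and c t :: 'a
      by (rule ind_eq_0) simp
    ultimately show ?thesis
      by (simp add: ind_edge_def map_poly_pCons ind_between_no_poles)
  qed
  have v: "ind_edge y0 y1 (vline_q [:- z, 1:] 1 x) = \<kappa> * sgn (x - a)" for x
  proof -
    define P Q where "P = [:x - a:]" and "Q = [:- b, 1:]"
    have line: "vline_q [:- z, 1:] 1 x = [:Cplx x 0 - z, Cplx 0 1:]"
      by (simp add: vline_q_def vline_def pcompose_1 pcompose_pCons)
    have PQ: "map_poly re (vline_q [:- z, 1:] 1 x) = P" "map_poly im (vline_q [:- z, 1:] 1 x) = Q"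
      unfolding line by (simp_all add: map_poly_pCons P_def Q_def a_def b_def)
    have ind: "ind e P Q t = (if t = b then e * sgn (x - a) / 2 else 0)" for e t
    proof (cases "x = a")
      case True
      then show ?thesis by (simp add: ind_def P_def)
    next
      case False
      then have "poly P t \<noteq> 0 \<or> poly Q t \<noteq> 0" by (simp add: P_def)
      moreover have "sg e P u = sgn (x - a)" for u
        using False by (simp add: P_def sg_eq_sgn)
      moreover have "poly Q t = 0 \<longleftrightarrow> t = b" by (auto simp: Q_def)
      ultimately show ?thesis
        by (simp add: ind_coprime sg_mult) (simp add: Q_def sg_linear)
    qed
    have "ind_between y0 y1 P Q = ind 1 P Q y0
        + (\<Sum>t\<in>{b} \<inter> {y0<..<y1}. ind 1 P Q t - ind (- 1) P Q t) - ind (- 1) P Q y1"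
      by (rule ind_between_eq[OF y_less]) (auto simp: Q_def)
    also have "\<dots> = \<kappa> * sgn (x - a)"
      using y_less by (auto simp: ind \<kappa>_def Int_insert_left)
    finally show ?thesis by (simp add: ind_edge_def PQ)
  qed
  have "w [:- z, 1:] 1 = (\<kappa> * sgn (x1 - a) - \<kappa> * sgn (x0 - a)) / 2"
    by (simp only: wind_rect_def ind_edge_swap[OF x_less] ind_edge_swap[OF y_less] h v) simp
  moreover have "\<not> ((a = x0 \<or> a = x1) \<and> (b = y0 \<or> b = y1))"
    using assms by (auto simp: corners_def cplx_eq_iff a_def b_def)
  ultimately show ?thesis
    using x_less y_less unfolding zeros_linear
    by (auto simp: \<kappa>_def in_rect_def c_rect_def in_interior_def a_def[symmetric] b_def[symmetric] sgn_if)
qed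

text \<open>Algebraic closedness supplies a linear factor; both sides are additive when it is split
  off.\<close>

lemma wind_rect_polynomial:
  assumes "F \<noteq> 0" and "\<And>z. z \<in> corners \<Longrightarrow> poly F z \<noteq> 0"
  shows "w F 1 = zeros F"
  using assms
proof (induction "degree F" arbitrary: F rule: less_induct)
  case less
  show ?case
  proof (cases "degree F = 0")
    case True
    then obtain c where "F = [:c:]" by (rule degree_eq_zeroE)
    then show ?thesis
      using less.prems(1) by (simp add: wind_rect_const zeros_def)
  next
    case False
    then obtain z where "poly F z = 0"
      using alg_closed_imp_poly_has_root[of F] by auto
    then obtain H where F: "F = [:- z, 1:] * H"
      by (auto simp: poly_eq_0_iff_dvd elim: dvdE)
    have "H \<noteq> 0" using F less.prems(1) by auto
    have "degree F = degree [:- z, 1:] + degree H"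
      unfolding F by (rule degree_mult_eq) (use \<open>H \<noteq> 0\<close> in auto)
    then have "degree H < degree F" by simp
    have H: "poly H u \<noteq> 0" "poly [:- z, 1:] u \<noteq> 0" if "u \<in> corners" for u
      using less.prems(2)[OF that] unfolding F poly_mult by auto
    have "w F 1 = w [:- z, 1:] 1 + w H 1"
      using wind_rect_mult[of "[:- z, 1:]" 1 H 1] H F by simp
    also have "w [:- z, 1:] 1 = zeros [:- z, 1:]"
      using H(2)[of z] by (intro wind_rect_linear) auto
    also have "w H 1 = zeros H"
      using less.hyps \<open>degree H < degree F\<close> \<open>H \<noteq> 0\<close> H(1) by blast
    also have "zeros [:- z, 1:] + zeros H = zeros F"
      unfolding F by (rule zeros_mult[symmetric]) (simp, fact)
    finally show ?thesis .
  qed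
qed

text \<open>Valuation 0 at a corner still permits a common zero of \<open>F\<close> and
  \<open>G\<close> there. Such a zero is cancelled, by induction on the degree, until additivity
  applies.\<close>

lemma wind_rect_eq_zeros:
  assumes "F \<noteq> 0" and "G \<noteq> 0" and "\<And>z. z \<in> corners \<Longrightarrow> val_c F G z = 0"
  shows "w F G = zeros F - zeros G"
  using assms
proof (induction "degree F" arbitrary: F G rule: less_induct)
  case less
  show ?case
  proof (cases "\<exists>z\<in>corners. poly F z = 0 \<or> poly G z = 0")
    case True
    then obtain z where z: "z \<in> corners" "poly F z = 0 \<or> poly G z = 0" by blast
    have "Polynomial.order z F = Polynomial.order z G"
      using less.prems(3)[OF z(1)] by (simp add: val_c_def)
    then have "poly F z = 0" "poly G z = 0"
      using z(2) less.prems(1,2) by (auto simp: order_root)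
    then obtain F' G' where F: "F = [:- z, 1:] * F'" and G: "G = [:- z, 1:] * G'"
      by (auto simp: poly_eq_0_iff_dvd elim!: dvdE)
    have nz: "F' \<noteq> 0" "G' \<noteq> 0" using F G less.prems(1,2) by auto
    have "degree F = degree [:- z, 1:] + degree F'"
      unfolding F by (rule degree_mult_eq) (use nz in auto)
    then have "degree F' < degree F" by simp
    moreover have "val_c F' G' u = 0" if "u \<in> corners" for u
    proof -
      have "Polynomial.order u F = Polynomial.order u [:- z, 1:] + Polynomial.order u F'"
        "Polynomial.order u G = Polynomial.order u [:- z, 1:] + Polynomial.order u G'"
        using order_mult[of "[:- z, 1:]" F'] order_mult[of "[:- z, 1:]" G'] nz F G
          less.prems(1,2) by metis+
      then show ?thesis
        using less.prems(3)[OF that] by (simp add: val_c_def)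
    qed
    ultimately have "w F' G' = zeros F' - zeros G'"
      using less.hyps nz by blast
    moreover have "w F G = w F' G'"
      unfolding F G by (rule wind_rect_cancel) simp
    moreover have "zeros F = zeros [:- z, 1:] + zeros F'" "zeros G = zeros [:- z, 1:] + zeros G'"
      unfolding F G by (rule zeros_mult, simp, rule nz)+
    ultimately show ?thesis by simp
  next
    case False
    \<comment> \<open>\<open>F / G\<close> is the product of \<open>F / 1\<close> and
      \<open>1 / G\<close>, all nonvanishing at the corners.\<close>
    then have "w F G = w F 1 + w 1 G"
      using wind_rect_mult[of F 1 1 G] by simp
    also have "\<dots> = zeros F - zeros G"
      using False less.prems(1,2) by (simp add: wind_rect_inverse wind_rect_polynomial)
    finally show ?thesis .
  qed
qed

text \<open>The sum is extended to all zeros of \<open>F\<close> or \<open>G\<close>, where the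
  added terms are 0, and is then split linearly.\<close>

lemma sum_val_c:
  assumes "F \<noteq> 0" and "G \<noteq> 0"
  shows "(\<Sum>z\<in>{z. in_rect x0 x1 y0 y1 z \<and> val_c F G z \<noteq> 0}.
    c_rect x0 x1 y0 y1 z * of_int (val_c F G z)) = zeros F - zeros G"
proof -
  define A where "A = {z. in_rect x0 x1 y0 y1 z \<and> (poly F z = 0 \<or> poly G z = 0)}"
  have "finite A"
    by (rule finite_subset[of _ "{z. poly F z = 0} \<union> {z. poly G z = 0}"])
      (use assms in \<open>auto simp: A_def poly_roots_finite\<close>)
  have "(\<Sum>z\<in>{z. in_rect x0 x1 y0 y1 z \<and> val_c F G z \<noteq> 0}. c_rect x0 x1 y0 y1 z * of_int (val_c F G z))
      = (\<Sum>z\<in>A. c_rect x0 x1 y0 y1 z * of_int (val_c F G z))"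
    by (rule sum.mono_neutral_left[OF \<open>finite A\<close>]) (use assms in \<open>auto simp: A_def val_c_def order_root\<close>)
  also have "\<dots> = (\<Sum>z\<in>A. c_rect x0 x1 y0 y1 z * of_nat (Polynomial.order z F))
      - (\<Sum>z\<in>A. c_rect x0 x1 y0 y1 z * of_nat (Polynomial.order z G))"
    by (simp add: val_c_def sum_subtractf[symmetric] algebra_simps)
  also have "\<dots> = zeros F - zeros G"
  proof -
    have "zeros p = (\<Sum>z\<in>A. c_rect x0 x1 y0 y1 z * of_nat (Polynomial.order z p))" if "p \<in> {F, G}" for p
      using that assms \<open>finite A\<close> by (intro zeros_eq) (auto simp: A_def)
    then show ?thesis by simp
  qed
  finally show ?thesis .
qed

end

theorem theorem1p14:
  fixes F G :: "'a::real_closed_field cplx poly" and x0 x1 y0 y1 :: 'a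
  assumes "F \<noteq> 0" and "G \<noteq> 0"
    and "x0 < x1" and "y0 < y1"
    and "val_c F G (Cplx x0 y0) = 0" and "val_c F G (Cplx x1 y0) = 0"
    and "val_c F G (Cplx x1 y1) = 0" and "val_c F G (Cplx x0 y1) = 0"
  shows "wind_rect F G x0 x1 y0 y1 =
    (\<Sum>z\<in>{z. in_rect x0 x1 y0 y1 z \<and> val_c F G z \<noteq> 0}.
        c_rect x0 x1 y0 y1 z * of_int (val_c F G z))"
proof -
  interpret rectangle x0 x1 y0 y1
    using assms by unfold_locales
  have "\<And>z. z \<in> corners \<Longrightarrow> val_c F G z = 0"
    using assms by (auto simp: corners_def)
  with assms show ?thesis
    by (simp add: wind_rect_eq_zeros sum_val_c)
qed

end
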